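(* The class of bichain graphs is a minimal hereditary class of unbounded clique-width: it has unbounded clique-width, and every proper hereditary subclass of it has bounded clique-width.
   Context: A set of vertices forms a chain if their neighbourhoods are linearly ordered by inclusion. A bichain graph is a bipartite graph admitting a bipartition in which each of the two parts can be divided into at most two chains. A hereditary class is one closed under induced subgraphs. The clique-width of $G$ is the least size of a label set $\Sigma$ such that $G$ can be built using the operations: create a single vertex with label $i\in\Sigma$; for distinct $i,j$, add all edges between vertices labelled $i$ and vertices labelled $j$; relabel all vertices labelled $i$ to $j$; take disjoint unions of already constructed labelled graphs. A class has bounded clique-width if some constant bounds the clique-width of all its members. *)

theory Defs
  imports Main
begin

text \<open>A (finite, simple, undirected) graph on vertices of type 'a is a pair (V, E)
  of a vertex set and a set of ordered pairs (edges stored in both orientations).\<close>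

type_synonym 'a graph = "'a set \<times> ('a \<times> 'a) set"

definition verts :: "'a graph \<Rightarrow> 'a set" where "verts G = fst G"
definition edges :: "'a graph \<Rightarrow> ('a \<times> 'a) set" where "edges G = snd G"

definition wf_graph :: "'a graph \<Rightarrow> bool" where
  "wf_graph G \<longleftrightarrow> finite (verts G) \<and> edges G \<subseteq> verts G \<times> verts G
     \<and> (\<forall>x y. (x, y) \<in> edges G \<longrightarrow> (y, x) \<in> edges G)
     \<and> (\<forall>x. (x, x) \<notin> edges G)"

definition nbhd :: "'a graph \<Rightarrow> 'a \<Rightarrow> 'a set" where
  "nbhd G v = {u. (v, u) \<in> edges G}"

definition induced :: "'a graph \<Rightarrow> 'a set \<Rightarrow> 'a graph" where
  "induced G U = (U, edges G \<inter> (U \<times> U))"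

definition graph_iso :: "'a graph \<Rightarrow> 'b graph \<Rightarrow> bool" where
  "graph_iso G H \<longleftrightarrow> (\<exists>f. bij_betw f (verts G) (verts H) \<and>
     (\<forall>x\<in>verts G. \<forall>y\<in>verts G. (x, y) \<in> edges G \<longleftrightarrow> (f x, f y) \<in> edges H))"

definition is_chain :: "'a graph \<Rightarrow> 'a set \<Rightarrow> bool" where
  "is_chain G S \<longleftrightarrow> (\<forall>x\<in>S. \<forall>y\<in>S. nbhd G x \<subseteq> nbhd G y \<or> nbhd G y \<subseteq> nbhd G x)"

definition bichain :: "'a graph \<Rightarrow> bool" where
  "bichain G \<longleftrightarrow> (\<exists>A B. A \<union> B = verts G \<and> A \<inter> B = {} \<and>
     (\<forall>x y. (x, y) \<in> edges G \<longrightarrow> (x \<in> A \<and> y \<in> B) \<or> (x \<in> B \<and> y \<in> A)) \<and>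
     (\<exists>A1 A2. A = A1 \<union> A2 \<and> is_chain G A1 \<and> is_chain G A2) \<and>
     (\<exists>B1 B2. B = B1 \<union> B2 \<and> is_chain G B1 \<and> is_chain G B2))"

text \<open>Graph classes: sets of well-formed graphs on vertex type nat (every finite graph
  has an isomorphic copy there). A hereditary class is closed under isomorphism and
  induced subgraphs.\<close>
definition hereditary :: "nat graph set \<Rightarrow> bool" where
  "hereditary X \<longleftrightarrow> (\<forall>G\<in>X. wf_graph G) \<and>
     (\<forall>G\<in>X. \<forall>U. U \<subseteq> verts G \<longrightarrow> induced G U \<in> X) \<and>
     (\<forall>G\<in>X. \<forall>H. wf_graph H \<longrightarrow> graph_iso H G \<longrightarrow> H \<in> X)"

definition bichain_class :: "nat graph set" where
  "bichain_class = {G. wf_graph G \<and> bichain G}"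

inductive cwc :: "nat \<Rightarrow> 'a set \<Rightarrow> ('a \<times> 'a) set \<Rightarrow> ('a \<Rightarrow> nat) \<Rightarrow> bool" for k where
  empty: "cwc k {} {} lab"
| single: "lab v < k \<Longrightarrow> cwc k {v} {} lab"
| join: "cwc k V E lab \<Longrightarrow> i \<noteq> j \<Longrightarrow> i < k \<Longrightarrow> j < k \<Longrightarrow>
     cwc k V (E \<union> {(x, y). x \<in> V \<and> y \<in> V \<and>
        ((lab x = i \<and> lab y = j) \<or> (lab x = j \<and> lab y = i))}) lab"
| relabel: "cwc k V E lab \<Longrightarrow> i < k \<Longrightarrow> j < k \<Longrightarrow>
     cwc k V E (\<lambda>x. if lab x = i then j else lab x)"
| union: "cwc k V1 E1 l1 \<Longrightarrow> cwc k V2 E2 l2 \<Longrightarrow> V1 \<inter> V2 = {} \<Longrightarrow>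
     cwc k (V1 \<union> V2) (E1 \<union> E2) (\<lambda>x. if x \<in> V1 then l1 x else l2 x)"

definition cw_at_most :: "nat \<Rightarrow> 'a graph \<Rightarrow> bool" where
  "cw_at_most k G \<longleftrightarrow> (\<exists>lab. cwc k (verts G) (edges G) lab)"

definition bounded_cw :: "'a graph set \<Rightarrow> bool" where
  "bounded_cw X \<longleftrightarrow> (\<exists>k. \<forall>G\<in>X. cw_at_most k G)"

end

theory Submission
  imports Defs Complex_Main "HOL-Library.Product_Lexorder"
begin

text \<open>
  Every bichain graph can be drawn on a staircase: each vertex gets a column and a height, the
  parity of the column gives the side of the bipartition, adjacency between neighbouring columns is
  decided by comparing heights, and between columns further apart it depends only on the order and
  parity of the columns.

  Lower bound: in a full grid drawn this way, a set of roughly a third of the vertices with few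
  distinct neighbourhoods outside itself cannot exist. Many columns meeting both the set and (three
  columns further) its complement already give many neighbourhoods; otherwise one column is contained
  in the set and another one in the complement, and every row switches sides somewhere.

  Upper bound: in a window of consecutive columns, climb greedily, a vertex surviving the next round
  if both neighbouring columns contain a survivor below it. If every column survives long enough, the
  lowest survivors of each round contain any prescribed bichain graph. If some column dies out,
  tracing back the reason gives a curve from top to bottom of the window that separates left from
  right with boundedly many neighbourhood types. Such cuts in consecutive windows, with the height
  order in between, form a linear layout of bounded width.
\<close>

section \<open>Linear layouts and separators\<close>

lemma cwc_facts:
  assumes "cwc k V E lab"
  shows "finite V \<and> E \<subseteq> V \<times> V \<and> (\<forall>x\<in>V. lab x < k)"
  using assms by induction auto

text \<open>Relabelling one label at a time could merge a label already moved with one not yet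
  moved. Labels therefore first go to a fresh block starting at \<open>a\<close>, and only then down
  to their targets, which is why \<open>a + b\<close> labels are required.\<close>

lemma cwc_relabel_map:
  assumes "cwc K V E lab" "\<forall>x\<in>V. lab x < a" "\<forall>i<a. f i < b" "a + b \<le> K"
  shows "\<exists>lab'. cwc K V E lab' \<and> (\<forall>x\<in>V. lab' x = f (lab x))"
proof -
  have "m \<le> a \<Longrightarrow> \<exists>l. cwc K V E l \<and> (\<forall>x\<in>V. l x = (if lab x < m then a + f (lab x) else lab x))" for m
  proof (induction m)
    case 0
    then show ?case using assms(1) by auto
  next
    case (Suc m)
    then obtain l where l: "cwc K V E l" "\<forall>x\<in>V. l x = (if lab x < m then a + f (lab x) else lab x)" by auto
    have "m < K" "a + f m < K" using Suc.prems assms(3,4) by (auto intro: less_le_trans)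
    note r = cwc.relabel[OF l(1) this]
    have "\<forall>x\<in>V. (if l x = m then a + f m else l x) = (if lab x < Suc m then a + f (lab x) else lab x)"
      using l(2) Suc.prems by auto
    then show ?case using r by blast
  qed
  from this[of a] obtain l0 where l0: "cwc K V E l0" "\<forall>x\<in>V. l0 x = a + f (lab x)"
    using assms(2) by auto
  have "m \<le> b \<Longrightarrow> \<exists>l. cwc K V E l \<and> (\<forall>x\<in>V. l x = (if f (lab x) < m then f (lab x) else a + f (lab x)))" for m
  proof (induction m)
    case 0
    then show ?case using l0 by auto
  next
    case (Suc m)
    then obtain l where l: "cwc K V E l" "\<forall>x\<in>V. l x = (if f (lab x) < m then f (lab x) else a + f (lab x))" by auto
    have "a + m < K" "m < K" using Suc.prems assms(4) by auto
    note r = cwc.relabel[OF l(1) this]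
    have "\<forall>x\<in>V. (if l x = a + m then m else l x) = (if f (lab x) < Suc m then f (lab x) else a + f (lab x))"
      using l(2) Suc.prems by auto
    then show ?case using r by blast
  qed
  from this[of b] show ?thesis using assms(2,3) by auto
qed

lemma cwc_join_set:
  assumes "finite I" "cwc K V E lab" "I \<subseteq> {..<K}" "p < K" "p \<notin> I"
  shows "cwc K V (E \<union> {(x, y). x \<in> V \<and> y \<in> V \<and>
     ((lab x \<in> I \<and> lab y = p) \<or> (lab x = p \<and> lab y \<in> I))}) lab"
  using assms
proof (induction I rule: finite_induct)
  case empty
  then show ?case by simp
next
  case (insert i I)
  then have "cwc K V (E \<union> {(x, y). x \<in> V \<and> y \<in> V \<and>
     ((lab x \<in> I \<and> lab y = p) \<or> (lab x = p \<and> lab y \<in> I))}) lab" by auto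
  from cwc.join[OF this, of i p] insert.prems
  have "cwc K V (E \<union> {(x, y). x \<in> V \<and> y \<in> V \<and>
     ((lab x \<in> I \<and> lab y = p) \<or> (lab x = p \<and> lab y \<in> I))} \<union>
     {(x, y). x \<in> V \<and> y \<in> V \<and> (lab x = i \<and> lab y = p \<or> lab x = p \<and> lab y = i)}) lab"
    by auto
  moreover have "E \<union> {(x, y). x \<in> V \<and> y \<in> V \<and>
     ((lab x \<in> I \<and> lab y = p) \<or> (lab x = p \<and> lab y \<in> I))} \<union>
     {(x, y). x \<in> V \<and> y \<in> V \<and> (lab x = i \<and> lab y = p \<or> lab x = p \<and> lab y = i)} = 
     E \<union> {(x, y). x \<in> V \<and> y \<in> V \<and>
     ((lab x \<in> insert i I \<and> lab y = p) \<or> (lab x = p \<and> lab y \<in> insert i I))}"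
    by auto
  ultimately show ?case by simp
qed

text \<open>Vertices are inserted in list order, and the label of a vertex encodes its neighbourhood
  among those still to come. A new vertex enters with the spare label \<open>k\<close>, is joined to
  the labels whose trace contains it, and the \<open>k + 1\<close> labels are then compressed to the
  at most \<open>k\<close> new traces. Compression through a fresh block accounts for
  \<open>2 * k + 1\<close>.\<close>

lemma cwc_linear:
  fixes E :: "('a \<times> 'a) set"
  assumes sym: "\<And>x y. (x, y) \<in> E \<Longrightarrow> (y, x) \<in> E" and irr: "\<And>x. (x, x) \<notin> E"
    and dist: "distinct xs"
    and div: "\<And>i. i \<le> length xs \<Longrightarrow>
      card ((\<lambda>x. E `` {x} \<inter> set (drop i xs)) ` set (take i xs)) \<le> k"
    and i: "i \<le> length xs"
  shows "\<exists>lab. cwc (2 * k + 1) (set (take i xs)) (E \<inter> set (take i xs) \<times> set (take i xs)) lab \<and>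
    (\<forall>x\<in>set (take i xs). lab x < k) \<and>
    (\<forall>x\<in>set (take i xs). \<forall>y\<in>set (take i xs). lab x = lab y \<longleftrightarrow>
       E `` {x} \<inter> set (drop i xs) = E `` {y} \<inter> set (drop i xs))"
  using i
proof (induction i)
  case 0
  show ?case using cwc.empty by auto
next
  case (Suc i)
  define P where "P = set (take i xs)"
  define v where "v = xs ! i"
  define T where "T = set (drop i xs)"
  define T' where "T' = set (drop (Suc i) xs)"
  have il: "i < length xs" using Suc.prems by simp
  have P': "set (take (Suc i) xs) = insert v P"
    using il by (simp add: take_Suc_conv_app_nth P_def v_def)
  have TT': "T = insert v T'"
    using il by (simp add: T_def T'_def v_def Cons_nth_drop_Suc[symmetric])
  have vP: "v \<notin> P"
    using distinct_take[OF dist, of "Suc i"] il by (simp add: take_Suc_conv_app_nth P_def v_def)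
  from Suc obtain l where l: "cwc (2 * k + 1) P (E \<inter> P \<times> P) l" "\<forall>x\<in>P. l x < k"
    "\<forall>x\<in>P. \<forall>y\<in>P. l x = l y \<longleftrightarrow> E `` {x} \<inter> T = E `` {y} \<inter> T"
    unfolding P_def T_def by auto
  define tr where "tr x = E `` {x} \<inter> T'" for x
  have "card (tr ` insert v P) \<le> k"
    using div[OF Suc.prems] unfolding P' tr_def T'_def .
  moreover have "finite (tr ` insert v P)" by (simp add: P_def)
  ultimately obtain g where g: "inj_on g (tr ` insert v P)" "g ` (tr ` insert v P) \<subseteq> {..<k}"
    using card_le_inj[of "tr ` insert v P" "{..<k}"] by auto
  have "cwc (2 * k + 1) (P \<union> {v}) (E \<inter> P \<times> P \<union> {}) (\<lambda>x. if x \<in> P then l x else k)"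
    by (rule cwc.union[OF l(1)]) (use vP in \<open>auto intro: cwc.single\<close>)
  then have u: "cwc (2 * k + 1) (insert v P) (E \<inter> P \<times> P) (\<lambda>x. if x \<in> P then l x else k)" by simp
  define l1 where "l1 = (\<lambda>x. if x \<in> P then l x else k)"
  \<comment> \<open>Equal labels mean equal traces on \<open>T\<close>, and \<open>v\<close> is in
    \<open>T\<close>, so adjacency to \<open>v\<close> is a property of the label alone.\<close>
  define I where "I = l ` {x \<in> P. (x, v) \<in> E}"
  have Ik: "I \<subseteq> {..<k}" using l(2) by (auto simp: I_def)
  have inI: "l x \<in> I \<longleftrightarrow> (x, v) \<in> E" if "x \<in> P" for x
  proof
    assume "l x \<in> I"
    then obtain y where y: "y \<in> P" "(y, v) \<in> E" "l x = l y" by (auto simp: I_def)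
    then have "E `` {x} \<inter> T = E `` {y} \<inter> T" using l(3) that by auto
    then show "(x, v) \<in> E" using y TT' by auto
  qed (use that I_def in auto)
  have u2: "cwc (2 * k + 1) (insert v P) (E \<inter> P \<times> P \<union> {(x, y). x \<in> insert v P \<and> y \<in> insert v P \<and>
     ((l1 x \<in> I \<and> l1 y = k) \<or> (l1 x = k \<and> l1 y \<in> I))}) l1"
    by (rule cwc_join_set) (use u Ik in \<open>auto simp: l1_def I_def P_def\<close>)
  have l1k: "l1 x = k \<longleftrightarrow> x = v" if "x \<in> insert v P" for x
    using that l(2) vP by (auto simp: l1_def)
  have l1I: "l1 x \<in> I \<longleftrightarrow> (x, v) \<in> E" if "x \<in> insert v P" for x
    using that inI vP Ik irr by (auto simp: l1_def)
  have "E \<inter> P \<times> P \<union> {(x, y). x \<in> insert v P \<and> y \<in> insert v P \<and>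
     ((l1 x \<in> I \<and> l1 y = k) \<or> (l1 x = k \<and> l1 y \<in> I))} = E \<inter> insert v P \<times> insert v P"
  proof (intro equalityI subrelI)
    fix x y assume "(x, y) \<in> E \<inter> P \<times> P \<union> {(x, y). x \<in> insert v P \<and> y \<in> insert v P \<and>
      ((l1 x \<in> I \<and> l1 y = k) \<or> (l1 x = k \<and> l1 y \<in> I))}"
    then consider "(x, y) \<in> E" "x \<in> P" "y \<in> P"
      | "x \<in> insert v P" "y \<in> insert v P" "l1 x \<in> I" "l1 y = k"
      | "x \<in> insert v P" "y \<in> insert v P" "l1 x = k" "l1 y \<in> I" by blast
    then have "(x, y) \<in> E \<and> x \<in> insert v P \<and> y \<in> insert v P"
    proof cases
      case 1
      then show ?thesis by blast
    next
      case 2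
      then show ?thesis using l1k[of y] l1I[of x] by blast
    next
      case 3
      then show ?thesis using l1k[of x] l1I[of y] sym by blast
    qed
    then show "(x, y) \<in> E \<inter> insert v P \<times> insert v P" by blast
  next
    fix x y assume "(x, y) \<in> E \<inter> insert v P \<times> insert v P"
    then have xy: "(x, y) \<in> E" "x \<in> insert v P" "y \<in> insert v P" by blast+
    from xy have "x = v \<and> y \<noteq> v \<or> x \<noteq> v \<and> y = v \<or> x \<in> P \<and> y \<in> P" using irr by blast
    then show "(x, y) \<in> E \<inter> P \<times> P \<union> {(x, y). x \<in> insert v P \<and> y \<in> insert v P \<and>
      ((l1 x \<in> I \<and> l1 y = k) \<or> (l1 x = k \<and> l1 y \<in> I))}"
      using l1k[OF xy(2)] l1k[OF xy(3)] l1I[OF xy(2)] l1I[OF xy(3)] sym[OF xy(1)] xy by blast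
  qed
  with u2 have u3: "cwc (2 * k + 1) (insert v P) (E \<inter> insert v P \<times> insert v P) l1" by simp
  \<comment> \<open>The label is sent to the code of the new trace of any vertex carrying it. The
    default \<open>i - 1\<close> only keeps labels carried by no vertex below
    \<open>k\<close>.\<close>
  define f where "f i = (if \<exists>x\<in>insert v P. l1 x = i then g (tr (SOME x. x \<in> insert v P \<and> l1 x = i)) else i - 1)" for i
  have f: "f (l1 x) = g (tr x)" if x: "x \<in> insert v P" for x
  proof -
    define y where "y = (SOME y. y \<in> insert v P \<and> l1 y = l1 x)"
    have y: "y \<in> insert v P" "l1 y = l1 x"
      using someI[of "\<lambda>y. y \<in> insert v P \<and> l1 y = l1 x" x] x unfolding y_def by auto
    have "tr y = tr x"
    proof (cases "x = v")
      case True
      then show ?thesis using y x l1k by metis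
    next
      case False
      then have "y \<noteq> v" using y x l1k by metis
      then have "l y = l x" "x \<in> P" "y \<in> P" using False x y by (auto simp: l1_def split: if_splits)
      then have "E `` {x} \<inter> T = E `` {y} \<inter> T" using l(3) by metis
      then show ?thesis unfolding tr_def TT' by blast
    qed
    moreover have "f (l1 x) = g (tr y)" using x unfolding f_def y_def by auto
    ultimately show ?thesis by simp
  qed
  have k0: "0 < k" using g(2) by auto
  have "\<forall>i<k+1. f i < k"
  proof (intro allI impI)
    fix i assume "i < k + 1"
    show "f i < k"
    proof (cases "\<exists>x\<in>insert v P. l1 x = i")
      case True
      then obtain x where "x \<in> insert v P" "l1 x = i" by auto
      then show ?thesis using f[of x] g(2) by auto
    next
      case False
      then show ?thesis using \<open>i < k + 1\<close> k0 by (auto simp: f_def)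
    qed
  qed
  moreover have "\<forall>x\<in>insert v P. l1 x < k + 1" using l(2) by (auto simp: l1_def less_Suc_eq)
  ultimately obtain l2 where l2: "cwc (2 * k + 1) (insert v P) (E \<inter> insert v P \<times> insert v P) l2"
    "\<forall>x\<in>insert v P. l2 x = f (l1 x)"
    using cwc_relabel_map[OF u3, of "k + 1" f k] by auto
  have l2': "l2 x = g (tr x)" if "x \<in> insert v P" for x by (metis that l2(2) f)
  have "\<forall>x\<in>insert v P. l2 x < k"
  proof
    fix x assume "x \<in> insert v P"
    then show "l2 x < k" using l2'[of x] g(2) by blast
  qed
  moreover have "\<forall>x\<in>insert v P. \<forall>y\<in>insert v P. l2 x = l2 y \<longleftrightarrow> tr x = tr y"
  proof (intro ballI)
    fix x y assume xy: "x \<in> insert v P" "y \<in> insert v P"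
    show "l2 x = l2 y \<longleftrightarrow> tr x = tr y"
      unfolding l2'[OF xy(1)] l2'[OF xy(2)] by (rule inj_on_eq_iff[OF g(1)]) (use xy in blast)+
  qed
  ultimately show ?case using l2(1) unfolding P' tr_def T'_def by blast
qed

lemma cw_at_most_linear:
  assumes wf: "wf_graph G" and dist: "distinct xs" and set: "set xs = verts G"
    and div: "\<And>i. i \<le> length xs \<Longrightarrow>
      card ((\<lambda>x. edges G `` {x} \<inter> set (drop i xs)) ` set (take i xs)) \<le> k"
  shows "cw_at_most (2 * k + 1) G"
proof -
  have "edges G \<inter> verts G \<times> verts G = edges G" using wf by (auto simp: wf_graph_def)
  then show ?thesis
    using cwc_linear[of "edges G" xs k "length xs", OF _ _ dist div] wf
    unfolding cw_at_most_def by (auto simp: wf_graph_def set)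
qed

section \<open>Balanced separators from clique-width expressions\<close>

text \<open>Descend in the expression as long as some part of a union has at least \<open>m\<close>
  vertices. Where this stops, both parts are smaller than \<open>m\<close>, so their union has fewer
  than \<open>2 * m\<close> vertices. Here \<open>l\<close> is the label inside the subexpression
  found; vertices sharing it are treated alike by every later operation, and carrying
  \<open>lab x = lab y\<close> along makes the induction work.\<close>

lemma cwc_separator:
  assumes "cwc k V E lab" "1 \<le> m" "m \<le> card V"
  shows "\<exists>S l. S \<subseteq> V \<and> m \<le> card S \<and> card S < 2 * m \<and> (\<forall>x\<in>S. l x < k) \<and>
    (\<forall>x\<in>S. \<forall>y\<in>S. l x = l y \<longrightarrow> lab x = lab y \<and> (\<forall>z\<in>V - S. (x, z) \<in> E \<longleftrightarrow> (y, z) \<in> E))"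
  using assms
proof induction
  case (empty lab)
  then show ?case by simp
next
  case (single lab v)
  then show ?case by (intro exI[of _ "{v}"] exI[of _ lab]) auto
next
  case (join V E lab i j)
  then obtain S l where S: "S \<subseteq> V" "m \<le> card S" "card S < 2 * m" "\<forall>x\<in>S. l x < k"
    "\<forall>x\<in>S. \<forall>y\<in>S. l x = l y \<longrightarrow> lab x = lab y \<and> (\<forall>z\<in>V - S. (x, z) \<in> E \<longleftrightarrow> (y, z) \<in> E)"
    by auto
  show ?case
  proof (intro exI[of _ S] exI[of _ l] conjI ballI impI S(1-3))
    fix x y assume xy: "x \<in> S" "y \<in> S" "l x = l y"
    then show lab: "lab x = lab y" using S(5) by blast
    fix z assume z: "z \<in> V - S"
    then have "(x, z) \<in> E \<longleftrightarrow> (y, z) \<in> E" using S(5) xy by blast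
    moreover have "x \<in> V" "y \<in> V" using xy S(1) by auto
    ultimately show "((x, z) \<in> E \<union> {(x, y). x \<in> V \<and> y \<in> V \<and> (lab x = i \<and> lab y = j \<or> lab x = j \<and> lab y = i)}) =
       ((y, z) \<in> E \<union> {(x, y). x \<in> V \<and> y \<in> V \<and> (lab x = i \<and> lab y = j \<or> lab x = j \<and> lab y = i)})"
      using lab by simp
  qed (use S(4) in blast)
next
  case (relabel V E lab i j)
  then obtain S l where S: "S \<subseteq> V" "m \<le> card S" "card S < 2 * m" "\<forall>x\<in>S. l x < k"
    "\<forall>x\<in>S. \<forall>y\<in>S. l x = l y \<longrightarrow> lab x = lab y \<and> (\<forall>z\<in>V - S. (x, z) \<in> E \<longleftrightarrow> (y, z) \<in> E)"
    by auto
  show ?case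
  proof (intro exI[of _ S] exI[of _ l] conjI ballI impI S(1-3))
    fix x y assume "x \<in> S" "y \<in> S" "l x = l y"
    then have xy: "lab x = lab y \<and> (\<forall>z\<in>V - S. (x, z) \<in> E \<longleftrightarrow> (y, z) \<in> E)" using S(5) by blast
    then show "(if lab x = i then j else lab x) = (if lab y = i then j else lab y)" by simp
    fix z assume "z \<in> V - S"
    then show "(x, z) \<in> E \<longleftrightarrow> (y, z) \<in> E" using xy by blast
  qed (use S(4) in blast)
next
  case (union V1 E1 l1 V2 E2 l2)
  let ?lab = "\<lambda>x. if x \<in> V1 then l1 x else l2 x"
  have f: "E1 \<subseteq> V1 \<times> V1" "E2 \<subseteq> V2 \<times> V2" "\<forall>x\<in>V1. l1 x < k" "\<forall>x\<in>V2. l2 x < k"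
    "finite V1" "finite V2"
    using union.hyps cwc_facts by blast+
  consider "m \<le> card V1" | "m \<le> card V2" | "card V1 < m" "card V2 < m" by linarith
  then show ?case
  proof cases
    case 1
    with union obtain S l where S: "S \<subseteq> V1" "m \<le> card S" "card S < 2 * m" "\<forall>x\<in>S. l x < k"
      "\<forall>x\<in>S. \<forall>y\<in>S. l x = l y \<longrightarrow> l1 x = l1 y \<and> (\<forall>z\<in>V1 - S. (x, z) \<in> E1 \<longleftrightarrow> (y, z) \<in> E1)"
      by blast
    have "\<forall>x\<in>S. \<forall>y\<in>S. l x = l y \<longrightarrow> ?lab x = ?lab y \<and> (\<forall>z\<in>V1 \<union> V2 - S. (x, z) \<in> E1 \<union> E2 \<longleftrightarrow> (y, z) \<in> E1 \<union> E2)"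
    proof (intro ballI impI conjI)
      fix x y assume xy: "x \<in> S" "y \<in> S" "l x = l y"
      then have V: "x \<in> V1" "y \<in> V1" "x \<notin> V2" "y \<notin> V2" using S(1) union.hyps by auto
      have "l1 x = l1 y" using S(5) xy by blast
      then show "?lab x = ?lab y" using V by simp
      fix z assume z: "z \<in> V1 \<union> V2 - S"
      have "(x, z) \<in> E1 \<longleftrightarrow> (y, z) \<in> E1"
      proof (cases "z \<in> V1")
        case True
        then show ?thesis using S(5) xy z by blast
      next
        case False
        then show ?thesis using f by blast
      qed
      moreover have "(x, z) \<notin> E2" "(y, z) \<notin> E2" using V f by blast+
      ultimately show "(x, z) \<in> E1 \<union> E2 \<longleftrightarrow> (y, z) \<in> E1 \<union> E2" by blast
    qed
    moreover have "S \<subseteq> V1 \<union> V2" using S(1) by blast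
    ultimately show ?thesis using S(2-4) by (intro exI[of _ S] exI[of _ l]) blast
  next
    case 2
    with union obtain S l where S: "S \<subseteq> V2" "m \<le> card S" "card S < 2 * m" "\<forall>x\<in>S. l x < k"
      "\<forall>x\<in>S. \<forall>y\<in>S. l x = l y \<longrightarrow> l2 x = l2 y \<and> (\<forall>z\<in>V2 - S. (x, z) \<in> E2 \<longleftrightarrow> (y, z) \<in> E2)"
      by blast
    have "\<forall>x\<in>S. \<forall>y\<in>S. l x = l y \<longrightarrow> ?lab x = ?lab y \<and> (\<forall>z\<in>V1 \<union> V2 - S. (x, z) \<in> E1 \<union> E2 \<longleftrightarrow> (y, z) \<in> E1 \<union> E2)"
    proof (intro ballI impI conjI)
      fix x y assume xy: "x \<in> S" "y \<in> S" "l x = l y"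
      then have V: "x \<in> V2" "y \<in> V2" "x \<notin> V1" "y \<notin> V1" using S(1) union.hyps by auto
      have "l2 x = l2 y" using S(5) xy by blast
      then show "?lab x = ?lab y" using V by simp
      fix z assume z: "z \<in> V1 \<union> V2 - S"
      have "(x, z) \<in> E2 \<longleftrightarrow> (y, z) \<in> E2"
      proof (cases "z \<in> V2")
        case True
        then show ?thesis using S(5) xy z by blast
      next
        case False
        then show ?thesis using f by blast
      qed
      moreover have "(x, z) \<notin> E1" "(y, z) \<notin> E1" using V f by blast+
      ultimately show "(x, z) \<in> E1 \<union> E2 \<longleftrightarrow> (y, z) \<in> E1 \<union> E2" by blast
    qed
    moreover have "S \<subseteq> V1 \<union> V2" using S(1) by blast
    ultimately show ?thesis using S(2-4) by (intro exI[of _ S] exI[of _ l]) blast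
  next
    case 3
    then have "card (V1 \<union> V2) < 2 * m" using card_Un_le[of V1 V2] by linarith
    moreover have "\<forall>x\<in>V1 \<union> V2. ?lab x < k" using f(3,4) by auto
    ultimately show ?thesis using union.prems by (intro exI[of _ "V1 \<union> V2"] exI[of _ ?lab]) blast
  qed
qed

section \<open>Staircase graphs\<close>

text \<open>Meant for columns of opposite parity: there, with injective heights, exactly one of two
  vertices is below the other. The relation is not transitive in general.\<close>

definition stair_less :: "('a \<Rightarrow> nat) \<Rightarrow> ('a \<Rightarrow> 'b::linorder) \<Rightarrow> 'a \<Rightarrow> 'a \<Rightarrow> bool" where
  "stair_less c h x y \<longleftrightarrow>
     c x + 1 < c y \<or> (c y = c x + 1 \<or> c x = c y + 1) \<and> h x < h y"

definition stair_adj :: "('a \<Rightarrow> nat) \<Rightarrow> ('a \<Rightarrow> 'b::linorder) \<Rightarrow> 'a \<Rightarrow> 'a \<Rightarrow> bool" where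
  "stair_adj c h x y \<longleftrightarrow>
     even (c x) \<and> odd (c y) \<and> stair_less c h y x \<or> odd (c x) \<and> even (c y) \<and> stair_less c h x y"

definition stair_graph :: "'a set \<Rightarrow> ('a \<Rightarrow> nat) \<Rightarrow> ('a \<Rightarrow> 'b::linorder) \<Rightarrow> 'a graph" where
  "stair_graph V c h = (V, {(x, y). x \<in> V \<and> y \<in> V \<and> stair_adj c h x y})"

lemma verts_stair_graph [simp]: "verts (stair_graph V c h) = V"
  by (simp add: verts_def stair_graph_def)

lemma edges_stair_graph [simp]:
  "(x, y) \<in> edges (stair_graph V c h) \<longleftrightarrow> x \<in> V \<and> y \<in> V \<and> stair_adj c h x y"
  by (simp add: edges_def stair_graph_def)

lemma wf_stair_graph: "finite V \<Longrightarrow> wf_graph (stair_graph V c h)"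
  by (auto simp: wf_graph_def stair_adj_def)

text \<open>Distinct columns congruent modulo 4 are at least 4 apart, so no column neighbours both
  and comparisons by height cannot conflict. Two columns at distance 2 would share the column
  between them, where neighbourhoods may cross.\<close>

lemma stair_adj_mono:
  assumes "c x mod 4 = c y mod 4" "c x < c y \<or> c x = c y \<and> h x \<le> h y"
  shows "even (c x) \<Longrightarrow> stair_adj c h x z \<Longrightarrow> stair_adj c h y z"
    and "odd (c x) \<Longrightarrow> stair_adj c h y z \<Longrightarrow> stair_adj c h x z"
proof -
  have "c x = c y \<and> h x \<le> h y \<or> c x + 4 \<le> c y"
  proof (cases "c x < c y")
    case True
    then have "c x + 4 \<le> c y" using assms(1) by presburger
    then show ?thesis by simp
  qed (use assms in auto)
  moreover have "even (c x) \<longleftrightarrow> even (c y)" using assms(1) by presburger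
  ultimately show "even (c x) \<Longrightarrow> stair_adj c h x z \<Longrightarrow> stair_adj c h y z"
    and "odd (c x) \<Longrightarrow> stair_adj c h y z \<Longrightarrow> stair_adj c h x z"
    by (auto simp: stair_adj_def stair_less_def)
qed

lemma is_chain_stair_graph: "is_chain (stair_graph V c h) {x \<in> V. c x mod 4 = i}"
proof -
  define G where "G = stair_graph V c h"
  have *: "nbhd G x \<subseteq> nbhd G y \<or> nbhd G y \<subseteq> nbhd G x"
    if "x \<in> V" "y \<in> V" "c x mod 4 = c y mod 4" "c x < c y \<or> c x = c y \<and> h x \<le> h y" for x y
  proof (cases "even (c x)")
    case True
    then have "nbhd G x \<subseteq> nbhd G y"
      using stair_adj_mono(1)[OF that(3,4)] that(1,2) by (auto simp: nbhd_def G_def)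
    then show ?thesis ..
  next
    case False
    then have "nbhd G y \<subseteq> nbhd G x"
      using stair_adj_mono(2)[OF that(3,4)] that(1,2) by (auto simp: nbhd_def G_def)
    then show ?thesis ..
  qed
  show ?thesis
    unfolding is_chain_def G_def[symmetric]
  proof (intro ballI)
    fix x y assume xy: "x \<in> {x \<in> V. c x mod 4 = i}" "y \<in> {x \<in> V. c x mod 4 = i}"
    consider "c x < c y \<or> c x = c y \<and> h x \<le> h y" | "c y < c x \<or> c y = c x \<and> h y \<le> h x"
      by force
    then show "nbhd G x \<subseteq> nbhd G y \<or> nbhd G y \<subseteq> nbhd G x"
      using *[of x y] *[of y x] xy by cases auto
  qed
qed

lemma bichain_stair_graph: "bichain (stair_graph V c h)"
proof -
  let ?C = "\<lambda>i. {x \<in> V. c x mod 4 = i}"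
  have "?C 0 \<union> ?C 2 \<union> (?C 1 \<union> ?C 3) = verts (stair_graph V c h)"
  proof -
    have "c x mod 4 = 0 \<or> c x mod 4 = 2 \<or> c x mod 4 = 1 \<or> c x mod 4 = 3" for x by presburger
    then show ?thesis by auto
  qed
  moreover have "(?C 0 \<union> ?C 2) \<inter> (?C 1 \<union> ?C 3) = {}" by auto
  moreover have "x \<in> ?C 0 \<union> ?C 2 \<and> y \<in> ?C 1 \<union> ?C 3 \<or> x \<in> ?C 1 \<union> ?C 3 \<and> y \<in> ?C 0 \<union> ?C 2"
    if "(x, y) \<in> edges (stair_graph V c h)" for x y
  proof -
    have e: "even n \<Longrightarrow> n mod 4 = 0 \<or> n mod 4 = 2" "odd n \<Longrightarrow> n mod 4 = 1 \<or> n mod 4 = 3" for n :: nat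
      by presburger+
    show ?thesis using that e[of "c x"] e[of "c y"] by (auto simp: stair_adj_def)
  qed
  ultimately show ?thesis
    unfolding bichain_def
    by (intro exI[of _ "?C 0 \<union> ?C 2"] exI[of _ "?C 1 \<union> ?C 3"] conjI allI impI
      exI[of _ "?C 0"] exI[of _ "?C 1"] exI[of _ "?C 2"] exI[of _ "?C 3"] is_chain_stair_graph refl)
qed

section \<open>Grids have large clique-width\<close>

lemma adjacent_change:
  fixes P :: "nat \<Rightarrow> bool"
  assumes "P a \<noteq> P b" "a < n" "b < n"
  shows "\<exists>j. j + 1 < n \<and> P j \<noteq> P (j + 1)"
proof (rule ccontr)
  assume no: "\<not> ?thesis"
  have "P j = P 0" if "j < n" for j
    using that
  proof (induction j)
    case (Suc j)
    then show ?case using no by simp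
  qed simp
  from this[of a] this[of b] show False using assms by blast
qed

text \<open>The number \<open>r * n + j\<close> is the vertex in row \<open>r\<close> and column
  \<open>j\<close>, and it serves as its own height. The value of \<open>q\<close> exceeds
  \<open>6 * k\<close> even after three columns are lost, and \<open>M\<close> exceeds the number of
  possible triples \<open>f r\<close> at the end of the argument.\<close>

lemma grid_cw_unbounded:
  assumes q: "q = 6 * k + 4" and n: "n = 3 * q" and M: "M = 2 * n * k + 1"
  shows "\<not> cw_at_most k (stair_graph {..<n * M} (\<lambda>x. x mod n) id)"
proof
  define V where "V = {..<n * M}"
  define c where "c x = x mod n" for x :: nat
  define adj where "adj = stair_adj c (id :: nat \<Rightarrow> nat)"
  have n0: "0 < n" "0 < q" "0 < M" using q n M by auto
  assume "cw_at_most k (stair_graph {..<n * M} (\<lambda>x. x mod n) id)"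
  then obtain lab where "cwc k V (edges (stair_graph V c id)) lab"
    by (auto simp: cw_at_most_def V_def c_def[abs_def])
  moreover have "1 \<le> q * M" "q * M \<le> card V" using n0 by (auto simp: V_def n)
  ultimately have "\<exists>S l. S \<subseteq> V \<and> q * M \<le> card S \<and> card S < 2 * (q * M) \<and> (\<forall>x\<in>S. l x < k) \<and>
    (\<forall>x\<in>S. \<forall>y\<in>S. l x = l y \<longrightarrow> lab x = lab y \<and>
      (\<forall>z\<in>V - S. (x, z) \<in> edges (stair_graph V c id) \<longleftrightarrow> (y, z) \<in> edges (stair_graph V c id)))"
    by (rule cwc_separator)
  then obtain S l where S: "S \<subseteq> V" "q * M \<le> card S" "card S < 2 * (q * M)" "\<forall>x\<in>S. l x < k"
    "\<forall>x\<in>S. \<forall>y\<in>S. l x = l y \<longrightarrow> lab x = lab y \<and>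
      (\<forall>z\<in>V - S. (x, z) \<in> edges (stair_graph V c id) \<longleftrightarrow> (y, z) \<in> edges (stair_graph V c id))"
    by (elim exE conjE) (rule that)
  define T where "T = V - S"
  have sep: "adj x z \<longleftrightarrow> adj y z" if "x \<in> S" "y \<in> S" "l x = l y" "z \<in> T" for x y z
    using that S(1,5) unfolding T_def adj_def edges_stair_graph by blast
  have fin: "finite V" "finite S" "finite T" using S(1) by (auto simp: V_def T_def finite_subset)
  have "card T = card V - card S" using S(1) fin by (simp add: T_def card_Diff_subset)
  then have T: "q * M \<le> card T" "T \<subseteq> V" using S(3) by (auto simp: V_def n T_def)
  \<comment> \<open>A column holds only \<open>M\<close> vertices, so a third of the grid meets at
    least \<open>q\<close> columns.\<close>
  have cols: "q \<le> card {j. j < n \<and> (\<exists>x\<in>X. c x = j)}" if "X \<subseteq> V" "q * M \<le> card X" for X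
  proof -
    let ?J = "{j. j < n \<and> (\<exists>x\<in>X. c x = j)}"
    have "inj_on (\<lambda>x. (x mod n, x div n)) X"
      by (rule inj_onI) (metis div_mult_mod_eq prod.inject)
    moreover have "(\<lambda>x. (x mod n, x div n)) ` X \<subseteq> ?J \<times> {..<M}"
      using that(1) n0 by (auto simp: V_def c_def less_mult_imp_div_less mult.commute)
    ultimately have "card X \<le> card (?J \<times> {..<M})" by (intro card_inj_on_le) auto
    then have "q * M \<le> card ?J * M"
      using that(2) unfolding card_cartesian_product card_lessThan by (rule order_trans[rotated])
    then show ?thesis using n0 by simp
  qed
  \<comment> \<open>For \<open>i < j\<close> congruent modulo 6, column \<open>i + 3\<close> lies at
    least three to the right of \<open>i\<close> and at least three to the left of \<open>j\<close>.
    Hence \<open>t i\<close> distinguishes \<open>s i\<close> from \<open>s j\<close>, and their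
    labels differ. This bounds \<open>J\<close> by \<open>6 * k\<close>.\<close>
  have key: False if J: "J \<subseteq> {..<n - 3}" "\<And>j. j \<in> J \<Longrightarrow> \<exists>x\<in>S. c x = j"
    "\<And>j. j \<in> J \<Longrightarrow> \<exists>x\<in>T. c x = j + 3" "q \<le> card J + 3" for J
  proof -
    have "\<exists>s. \<forall>j\<in>J. s j \<in> S \<and> c (s j) = j" by (rule bchoice) (use J(2) in blast)
    then obtain s where s: "\<And>j. j \<in> J \<Longrightarrow> s j \<in> S \<and> c (s j) = j" by blast
    have "\<exists>t. \<forall>j\<in>J. t j \<in> T \<and> c (t j) = j + 3" by (rule bchoice) (use J(3) in blast)
    then obtain t where t: "\<And>j. j \<in> J \<Longrightarrow> t j \<in> T \<and> c (t j) = j + 3" by blast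
    have ne: "l (s i) \<noteq> l (s j)" if ij: "i \<in> J" "j \<in> J" "i mod 6 = j mod 6" "i < j" for i j
    proof
      assume "l (s i) = l (s j)"
      then have "adj (s i) (t i) \<longleftrightarrow> adj (s j) (t i)" using sep[of "s i" "s j" "t i"] s t ij(1,2) by simp
      moreover have "6 dvd j - i" using ij(3,4) mod_eq_dvd_iff_nat[of i j 6] by simp
      then obtain m where "j = i + 6 * m" using ij(4) by (metis dvdE le_add_diff_inverse less_imp_le)
      then have "i + 6 \<le> j" "even i \<longleftrightarrow> even j" using ij(4) by auto
      ultimately show False
        using s[OF ij(1)] s[OF ij(2)] t[OF ij(1)]
        by (auto simp: adj_def stair_adj_def stair_less_def)
    qed
    have "inj_on (\<lambda>j. (j mod 6, l (s j))) J"
    proof (rule inj_onI)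
      fix i j assume "i \<in> J" "j \<in> J" "(i mod 6, l (s i)) = (j mod 6, l (s j))"
      then show "i = j" using ne[of i j] ne[of j i] by (cases i j rule: linorder_cases) auto
    qed
    moreover have "(\<lambda>j. (j mod 6, l (s j))) ` J \<subseteq> {..<6} \<times> {..<k}" using s S(4) by auto
    ultimately have "card J \<le> card ({..<6::nat} \<times> {..<k})" by (intro card_inj_on_le) auto
    then show False using J(4) q by (simp add: card_cartesian_product)
  qed
  \<comment> \<open>Otherwise every column meets \<open>T\<close>, and the columns meeting
    \<open>S\<close>, apart from the last three, contradict \<open>key\<close>. The dual argument
    below gives a column inside \<open>T\<close>.\<close>
  have "\<exists>p<n. \<forall>x\<in>V. c x = p \<longrightarrow> x \<in> S"
  proof (rule ccontr)
    assume "\<not> ?thesis"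
    then have all: "\<exists>x\<in>T. c x = p" if "p < n" for p using that by (auto simp: T_def)
    have "card {j. j < n \<and> (\<exists>x\<in>S. c x = j)} \<le> card ({j. j < n - 3 \<and> (\<exists>x\<in>S. c x = j)} \<union> {n-3..<n})"
      by (rule card_mono) auto
    also have "\<dots> \<le> card {j. j < n - 3 \<and> (\<exists>x\<in>S. c x = j)} + card {n-3..<n}" by (rule card_Un_le)
    finally have "q \<le> card {j. j < n - 3 \<and> (\<exists>x\<in>S. c x = j)} + 3"
      using cols[OF S(1,2)] by simp
    then show False by (intro key[of "{j. j < n - 3 \<and> (\<exists>x\<in>S. c x = j)}"]) (auto intro!: all)
  qed
  then obtain p where p: "p < n" "\<And>x. x \<in> V \<Longrightarrow> c x = p \<Longrightarrow> x \<in> S" by blast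
  have "\<exists>p<n. \<forall>x\<in>V. c x = p \<longrightarrow> x \<in> T"
  proof (rule ccontr)
    assume "\<not> ?thesis"
    then have all: "\<exists>x\<in>S. c x = p" if "p < n" for p using that by (auto simp: T_def)
    let ?J = "{j. j < n - 3 \<and> (\<exists>x\<in>T. c x = j + 3)}"
    have "{j. j < n \<and> (\<exists>x\<in>T. c x = j)} \<subseteq> (\<lambda>j. j + 3) ` ?J \<union> {..<3}"
    proof
      fix j assume "j \<in> {j. j < n \<and> (\<exists>x\<in>T. c x = j)}"
      then show "j \<in> (\<lambda>j. j + 3) ` ?J \<union> {..<3}"
        by (cases "j < 3") (auto intro!: image_eqI[of _ _ "j - 3"])
    qed
    then have "card {j. j < n \<and> (\<exists>x\<in>T. c x = j)} \<le> card ((\<lambda>j. j + 3) ` ?J \<union> {..<3})"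
      by (rule card_mono[rotated]) auto
    also have "\<dots> \<le> card ((\<lambda>j. j + 3) ` ?J) + card {..<3::nat}" by (rule card_Un_le)
    also have "card ((\<lambda>j. j + 3) ` ?J) = card ?J" by (rule card_image) auto
    finally have "q \<le> card ?J + 3"
      using cols[OF T(2,1)] by simp
    then show False by (intro key[of ?J]) (auto intro!: all)
  qed
  then obtain p' where p': "p' < n" "\<And>x. x \<in> V \<Longrightarrow> c x = p' \<Longrightarrow> x \<in> T" by blast
  have inV: "r * n + j \<in> V" if "r < M" "j < n" for r j
  proof -
    have "r * n + j < (r + 1) * n" using that by simp
    also have "\<dots> \<le> M * n" using that by (intro mult_right_mono) auto
    finally show ?thesis by (simp add: V_def mult.commute)
  qed
  have col: "c (r * n + j) = j" if "j < n" for r j using that by (simp add: c_def)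
  have "\<exists>j. j + 1 < n \<and> (r * n + j \<in> S) \<noteq> (r * n + (j + 1) \<in> S)" if "r < M" for r
  proof (rule adjacent_change[of "\<lambda>j. r * n + j \<in> S" p p' n])
    have "r * n + p \<in> S" using p(2)[OF inV[OF that p(1)] col[OF p(1)]] .
    moreover have "r * n + p' \<in> T" using p'(2)[OF inV[OF that p'(1)] col[OF p'(1)]] .
    ultimately show "(r * n + p \<in> S) \<noteq> (r * n + p' \<in> S)" by (simp add: T_def)
  qed (use p p' in auto)
  then have "\<forall>r\<in>{..<M}. \<exists>j. j + 1 < n \<and> (r * n + j \<in> S) \<noteq> (r * n + (j + 1) \<in> S)" by blast
  then have "\<exists>d. \<forall>r\<in>{..<M}. d r + 1 < n \<and> (r * n + d r \<in> S) \<noteq> (r * n + (d r + 1) \<in> S)"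
    by (rule bchoice)
  then obtain d where d: "\<And>r. r < M \<Longrightarrow> d r + 1 < n \<and> (r * n + d r \<in> S) \<noteq> (r * n + (d r + 1) \<in> S)"
    by blast
  define b where "b r = (r * n + d r \<in> S)" for r
  define s where "s r = (if b r then d r else d r + 1)" for r
  define t where "t r = (if b r then d r + 1 else d r)" for r
  have st: "r * n + s r \<in> S" "r * n + t r \<in> T" "s r < n" "t r < n" "s r = t r + 1 \<or> t r = s r + 1"
    if "r < M" for r
    using d[OF that] inV[OF that] by (auto simp: s_def t_def b_def T_def)
  define f where "f r = (d r, b r, l (r * n + s r))" for r
  \<comment> \<open>The two vertices of \<open>S\<close> in rows \<open>r\<close> and
    \<open>r'\<close> share a label, so the vertices of \<open>T\<close> beside them cannot tell
    them apart. The one in row \<open>r\<close> then forces \<open>s r\<close> to be right of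
    \<open>t r\<close>, the one in row \<open>r'\<close> forces it to be left.\<close>
  have ne: "f r \<noteq> f r'" if r: "r < r'" "r' < M" for r r'
  proof
    assume eq: "f r = f r'"
    then have s': "s r' = s r" "t r' = t r" and l: "l (r * n + s r) = l (r' * n + s r)"
      by (auto simp: f_def s_def t_def)
    have rM: "r < M" using r by simp
    have lt: "r * n + i < r' * n + j" if "i < n" for i j
    proof -
      have "r * n + i < (r + 1) * n" using that by simp
      also have "\<dots> \<le> r' * n" using r by (intro mult_right_mono) auto
      finally show ?thesis by simp
    qed
    have a: "adj x y \<longleftrightarrow> (if even (s r) then y < x else x < y)" if "c x = s r" "c y = t r" for x y
      using that st(5)[OF rM] by (auto simp: adj_def stair_adj_def stair_less_def)
    note cs = col[OF st(3)[OF rM]] col[OF st(4)[OF rM]]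
    have "adj (r * n + s r) z \<longleftrightarrow> adj (r' * n + s r) z" if "z \<in> T" for z
      using sep[OF _ _ l that] st(1)[OF rM] st(1)[OF r(2)] s' by simp
    from this[OF st(2)[OF rM]] this[OF st(2)[OF r(2)]]
    show False
      using lt[OF st(3)[OF rM], of "t r"] lt[OF st(4)[OF rM], of "s r"] st(5)[OF rM]
      unfolding s' a[OF cs] by (auto split: if_splits)
  qed
  have "inj_on f {..<M}"
  proof (rule inj_onI)
    fix i j assume "i \<in> {..<M}" "j \<in> {..<M}" "f i = f j"
    then show "i = j" using ne[of i j] ne[of j i] by (cases i j rule: linorder_cases) auto
  qed
  moreover have "f ` {..<M} \<subseteq> {..<n} \<times> UNIV \<times> {..<k}"
    using d st(1) S(4) by (fastforce simp: f_def)
  ultimately have "card {..<M} \<le> card ({..<n} \<times> (UNIV :: bool set) \<times> {..<k})"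
    by (intro card_inj_on_le) auto
  then show False by (simp add: card_cartesian_product M)
qed

lemma bichain_class_unbounded: "\<not> bounded_cw bichain_class"
proof
  assume "bounded_cw bichain_class"
  then obtain k where k: "\<And>G. G \<in> bichain_class \<Longrightarrow> cw_at_most k G" by (auto simp: bounded_cw_def)
  have "stair_graph {..<n} c (id :: nat \<Rightarrow> nat) \<in> bichain_class" for n c
    by (simp add: bichain_class_def bichain_stair_graph wf_stair_graph)
  then show False using k grid_cw_unbounded by blast
qed

section \<open>Windows of columns: embedding or cutting\<close>

locale staircase =
  fixes V :: "'a set" and c :: "'a \<Rightarrow> nat" and h :: "'a \<Rightarrow> real"
  assumes fin: "finite V" and inj: "inj_on h V"
begin

text \<open>From a vertex that survives \<open>k\<close> rounds, a strictly descending walk can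
  follow any prescribed sequence of \<open>k\<close> steps between neighbouring columns of the
  window \<open>{a..b}\<close>. Columns outside the window impose no condition.\<close>

primrec layer :: "nat \<Rightarrow> nat \<Rightarrow> nat \<Rightarrow> nat \<Rightarrow> 'a set" where
  "layer a b 0 j = {v \<in> V. c v = j}"
| "layer a b (Suc k) j =
     {v \<in> layer a b k j. \<forall>i\<in>{a..b}. i = j + 1 \<or> j = i + 1 \<longrightarrow> (\<exists>u\<in>layer a b k i. h u < h v)}"

lemma layer_sub: "layer a b k j \<subseteq> {v \<in> V. c v = j}"
  by (induction k) auto

lemma layer_antimono: "k \<le> l \<Longrightarrow> layer a b l j \<subseteq> layer a b k j"
  by (induction l rule: dec_induct) auto

lemma layer_upward:
  "v \<in> layer a b k j \<Longrightarrow> w \<in> V \<Longrightarrow> c w = j \<Longrightarrow> h v \<le> h w \<Longrightarrow> w \<in> layer a b k j"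
proof (induction k)
  case (Suc k)
  then show ?case by (simp, meson less_le_trans)
qed simp

lemma layer_below:
  assumes "v \<in> layer a b l j" "k < l" "i \<in> {a..b}" "i = j + 1 \<or> j = i + 1"
  shows "\<exists>u\<in>layer a b k i. h u < h v"
proof -
  have "v \<in> layer a b (Suc k) j" using layer_antimono[of "Suc k" l a b j] assms by auto
  then show ?thesis using assms by auto
qed

text \<open>The lowest survivor of a round lies below the lowest survivor of any later round in a
  neighbouring column, so rounds can play the role of heights: a vertex goes to its shifted column,
  at the round given by its height rank. Evenness of \<open>a\<close> preserves the column
  parities.\<close>

lemma embed_of_layers:
  fixes V' :: "'c set" and c' :: "'c \<Rightarrow> nat" and h' :: "'c \<Rightarrow> real"
  assumes ne: "\<And>j. j \<in> {a..b} \<Longrightarrow> layer a b K j \<noteq> {}" and ab: "even a" "a < b"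
    and V': "finite V'" "inj_on h' V'" "\<And>x. x \<in> V' \<Longrightarrow> a + c' x \<le> b" and K: "2 * card V' \<le> K"
  shows "\<exists>f. inj_on f V' \<and> f ` V' \<subseteq> V \<and>
    (\<forall>x\<in>V'. \<forall>y\<in>V'. stair_adj c' h' x y \<longleftrightarrow> stair_adj c h (f x) (f y))"
proof -
  define w where "w k j = arg_min_on h (layer a b k j)" for k j
  have w: "w k j \<in> layer a b k j" "\<And>u. u \<in> layer a b k j \<Longrightarrow> h (w k j) \<le> h u"
    if "k \<le> K" "j \<in> {a..b}" for k j
  proof -
    have ne': "layer a b k j \<noteq> {}" using ne[OF that(2)] layer_antimono[OF that(1), of a b j] by auto
    have f: "finite (layer a b k j)" using layer_sub by (rule finite_subset) (use fin in auto)
    show "w k j \<in> layer a b k j" unfolding w_def by (rule arg_min_if_finite(1)[OF f ne'])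
    show "\<And>u. u \<in> layer a b k j \<Longrightarrow> h (w k j) \<le> h u"
      unfolding w_def by (rule arg_min_least[OF f ne'])
  qed
  have wV: "w k j \<in> V" "c (w k j) = j" if "k \<le> K" "j \<in> {a..b}" for k j
    using w(1)[OF that] layer_sub[of a b k j] by auto
  have nb: "h (w k i) < h (w l j)"
    if klij: "k < l" "l \<le> K" "i \<in> {a..b}" "j \<in> {a..b}" "i = j + 1 \<or> j = i + 1" for k l i j
  proof -
    obtain u where "u \<in> layer a b k i" "h u < h (w l j)"
      using layer_below[OF w(1)[OF klij(2,4)] klij(1,3,5)] by auto
    then show ?thesis using w(2)[of k i u] klij by auto
  qed
  \<comment> \<open>Factor 2: two rounds are needed to climb strictly within a single column.\<close>
  define rk where "rk x = 2 * card {y \<in> V'. h' y < h' x}" for x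
  have rkK: "rk x \<le> K" for x
    using card_mono[OF V'(1), of "{y \<in> V'. h' y < h' x}"] K by (auto simp: rk_def)
  have rk: "rk x + 2 \<le> rk y" if "x \<in> V'" "h' x < h' y" for x y
  proof -
    have "card {z \<in> V'. h' z < h' x} < card {z \<in> V'. h' z < h' y}"
      by (rule psubset_card_mono) (use V' that in auto)
    then show ?thesis by (simp add: rk_def)
  qed
  define f where "f x = w (rk x) (a + c' x)" for x
  have fx: "f x \<in> V" "c (f x) = a + c' x" if "x \<in> V'" for x
    using wV[OF rkK[of x], of "a + c' x"] V'(3)[OF that] by (auto simp: f_def)
  have lt: "h (f x) < h (f y)"
    if "x \<in> V'" "y \<in> V'" "h' x < h' y" "c' x = c' y + 1 \<or> c' y = c' x + 1" for x y
    unfolding f_def by (rule nb) (use rk[of x y] rkK V'(3) that in auto)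
  have lt': "h (f x) < h (f y)" if "x \<in> V'" "y \<in> V'" "h' x < h' y" "c' x = c' y" for x y
  proof -
    \<comment> \<open>Two targets in one column are compared by a detour through a neighbouring
      column; \<open>a < b\<close> guarantees one in the window.\<close>
    define i where "i = (if a + c' x = a then a + 1 else a + c' x - 1)"
    have i: "i \<in> {a..b}" "i = a + c' x + 1 \<or> a + c' x = i + 1"
      using V'(3)[OF that(1)] ab by (auto simp: i_def)
    have "h (w (rk x) (a + c' x)) < h (w (rk x + 1) i)"
      by (rule nb) (use i rk[OF that(1,3)] rkK[of y] V'(3)[OF that(1)] in auto)
    also have "\<dots> < h (w (rk y) (a + c' x))"
      by (rule nb) (use i rk[OF that(1,3)] rkK[of y] V'(3)[OF that(1)] in auto)
    finally show ?thesis by (simp add: f_def that(4))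
  qed
  have ne': "h' x < h' y \<or> h' y < h' x" if "x \<in> V'" "y \<in> V'" "x \<noteq> y" for x y
    using V'(2) that by (metis inj_on_def linorder_neqE)
  have "inj_on f V'"
  proof (rule inj_onI, rule ccontr)
    fix x y assume xy: "x \<in> V'" "y \<in> V'" "f x = f y" "x \<noteq> y"
    then have "c' x = c' y" using fx(2)[of x] fx(2)[of y] by simp
    then show False using ne'[of x y] lt'[of x y] lt'[of y x] xy by auto
  qed
  moreover have less: "stair_less c' h' x y \<longleftrightarrow> stair_less c h (f x) (f y)" if xy: "x \<in> V'" "y \<in> V'" for x y
  proof (cases "c' x = c' y + 1 \<or> c' y = c' x + 1")
    case True
    then have "x \<noteq> y" by auto
    then have "h' x < h' y \<longleftrightarrow> h (f x) < h (f y)"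
      using ne'[OF xy] lt[OF xy] lt[OF xy(2,1)] True by fastforce
    then show ?thesis using True fx[OF xy(1)] fx[OF xy(2)] by (auto simp: stair_less_def)
  next
    case False
    then show ?thesis using fx[OF xy(1)] fx[OF xy(2)] by (auto simp: stair_less_def)
  qed
  then have "stair_adj c' h' x y \<longleftrightarrow> stair_adj c h (f x) (f y)" if "x \<in> V'" "y \<in> V'" for x y
    using less[of x y] less[of y x] fx(2)[of x] fx(2)[of y] ab that by (auto simp: stair_adj_def)
  ultimately show ?thesis using fx(1) by blast
qed

section \<open>Levels and separating curves\<close>

definition lev :: "nat \<Rightarrow> nat \<Rightarrow> nat \<Rightarrow> 'a \<Rightarrow> nat" where
  "lev a b K v = Max {k. k \<le> K \<and> v \<in> layer a b k (c v)}"

lemma lev_le: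
  assumes "v \<in> V"
  shows "lev a b K v \<le> K" and "k \<le> K \<Longrightarrow> v \<in> layer a b k (c v) \<longleftrightarrow> k \<le> lev a b K v"
proof -
  let ?A = "{k. k \<le> K \<and> v \<in> layer a b k (c v)}"
  have "finite ?A" "0 \<in> ?A" using assms by auto
  then have m: "lev a b K v \<in> ?A" unfolding lev_def by (intro Max_in) auto
  then show "lev a b K v \<le> K" by auto
  assume "k \<le> K"
  moreover have "k \<le> lev a b K v" if "v \<in> layer a b k (c v)"
    unfolding lev_def using \<open>finite ?A\<close> that \<open>k \<le> K\<close> by (intro Max_ge) auto
  ultimately show "v \<in> layer a b k (c v) \<longleftrightarrow> k \<le> lev a b K v"
    using m layer_antimono[of k "lev a b K v" a b "c v"] by auto
qed

text \<open>A separating curve in column \<open>p\<close> at level \<open>Suc k\<close> may continue in column \<open>q\<close> at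
  level \<open>k\<close>.\<close>

definition curve_step :: "nat \<Rightarrow> nat \<Rightarrow> nat \<Rightarrow> nat \<Rightarrow> nat \<Rightarrow> bool" where
  "curve_step a b k p q \<longleftrightarrow>
     q = p \<and> layer a b (Suc k) p = layer a b k p \<or>
     (q = p + 1 \<or> p = q + 1) \<and>
       (\<forall>u\<in>V. c u = p \<longrightarrow> u \<notin> layer a b (Suc k) p \<longrightarrow> (\<forall>v\<in>layer a b k q. h u < h v))"

text \<open>If the column loses vertices in this round, let \<open>v\<close> be the highest one
  lost. Some neighbouring column has no survivor below \<open>v\<close>, so its survivors all lie
  above \<open>v\<close>, while everything already lost in column \<open>p\<close> lies at or below
  \<open>v\<close>.\<close>

lemma curve_step_exists:
  assumes "p \<in> {a..b}"
  shows "\<exists>q\<in>{a..b}. curve_step a b k p q"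
proof (cases "layer a b (Suc k) p = layer a b k p")
  case True
  then show ?thesis using assms by (auto simp: curve_step_def)
next
  case False
  let ?D = "layer a b k p - layer a b (Suc k) p"
  have "?D \<noteq> {}" using False by auto
  moreover have "finite ?D" using layer_sub[of a b k p] fin by (auto intro: finite_subset)
  ultimately have "Max (h ` ?D) \<in> h ` ?D" by (intro Max_in) auto
  from this[unfolded image_iff] obtain v where v: "v \<in> ?D" "Max (h ` ?D) = h v" by (rule bexE)
  have vmax: "h u \<le> h v" if "u \<in> ?D" for u
    unfolding v(2)[symmetric] by (rule Max_ge) (use \<open>finite ?D\<close> that in auto)
  from v(1) obtain q where q: "q \<in> {a..b}" "q = p + 1 \<or> p = q + 1" "\<And>u. u \<in> layer a b k q \<Longrightarrow> \<not> h u < h v"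
    by auto
  have vV: "v \<in> V" "c v = p" using v(1) layer_sub[of a b k p] by auto
  have "h u < h w" if u: "u \<in> V" "c u = p" "u \<notin> layer a b (Suc k) p" and w: "w \<in> layer a b k q" for u w
  proof -
    have wV: "w \<in> V" "c w = q" using w layer_sub[of a b k q] by auto
    then have "w \<noteq> v" using vV q(2) by auto
    then have "h v < h w" using q(3)[OF w] inj wV vV by (metis inj_on_def linorder_neqE)
    moreover have "h u \<le> h v"
    proof (cases "u \<in> layer a b k p")
      case True
      then show ?thesis using vmax u by auto
    next
      case False
      then show ?thesis using layer_upward[of v a b k p u] v(1) u by fastforce
    qed
    ultimately show ?thesis by simp
  qed
  then have "curve_step a b k p q" using q(2) unfolding curve_step_def by blast
  then show ?thesis using q(1) by blast
qed

text \<open>Causes are traced back from round \<open>K\<close> to round 0. The last equation pads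
  the curve by one round, so that \<open>g (Suc k)\<close> also makes sense for vertices of the top
  level \<open>K\<close>.\<close>

lemma curve_exists:
  assumes "p \<in> {a..b}"
  shows "\<exists>g. g K = p \<and> (\<forall>k. g k \<in> {a..b}) \<and> (\<forall>k<K. curve_step a b k (g (Suc k)) (g k)) \<and> g (Suc K) = g K"
  using assms
proof (induction K arbitrary: p)
  case 0
  then show ?case by (intro exI[of _ "\<lambda>_. p"]) auto
next
  case (Suc K)
  obtain q where q: "q \<in> {a..b}" "curve_step a b K p q" using curve_step_exists[OF Suc.prems, of K] by auto
  from Suc.IH[OF q(1)] obtain g where g: "g K = q" "\<forall>k. g k \<in> {a..b}"
    "\<forall>k<K. curve_step a b k (g (Suc k)) (g k)" by auto
  show ?case
    by (rule exI[of _ "\<lambda>k. if k \<le> K then g k else p"]) (use g q Suc.prems in \<open>auto simp: less_Suc_eq\<close>)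
qed

text \<open>Left of the window only the parity of the column matters. The offset 2 keeps these two
  codes apart from those of the window columns.\<close>

definition cut_class :: "nat \<Rightarrow> nat \<Rightarrow> nat \<Rightarrow> 'a \<Rightarrow> nat \<times> nat" where
  "cut_class a b K x = (if c x < a then (c x mod 2, 0) else (2 + (c x - a), lev a b K x))"

text \<open>Start the curve at the empty top layer of column \<open>j0\<close> and let
  \<open>S\<close> be what lies to its left. Two vertices of \<open>S\<close> in one column and
  level could only be told apart from outside by a vertex of a neighbouring column with height in
  between, and the curve excludes this.\<close>

lemma cut_exists:
  assumes j0: "j0 \<in> {a..b}" and empty: "layer a b K j0 = {}"
  shows "\<exists>S\<subseteq>V. (\<forall>v\<in>V. c v \<le> a \<longrightarrow> v \<in> S) \<and> (\<forall>v\<in>S. c v < b) \<and>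
    (\<forall>x\<in>S. \<forall>y\<in>S. \<forall>z\<in>V - S. cut_class a b K x = cut_class a b K y \<longrightarrow>
       (stair_adj c h x z \<longleftrightarrow> stair_adj c h y z))"
proof -
  obtain g where g: "g K = j0" "\<And>k. g k \<in> {a..b}" "\<And>k. k < K \<Longrightarrow> curve_step a b k (g (Suc k)) (g k)"
    "g (Suc K) = g K" using curve_exists[OF j0, of K] by blast
  let ?L = "lev a b K"
  \<comment> \<open>At level \<open>k\<close> the curve runs from column \<open>g k\<close> to
    column \<open>g (Suc k)\<close>. With \<open>max\<close>, the left one of two distinct columns
    belongs to \<open>S\<close>.\<close>
  define S where "S = {v \<in> V. c v < max (g (?L v)) (g (Suc (?L v)))}"
  \<comment> \<open>The next fact, \<open>out\<close>, rests on the following: where the curve stays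
    in a column for a round, no vertex of that column has this level, and at level \<open>K\<close>
    the column \<open>g K = j0\<close> is empty.\<close>
  have step: "g (Suc k) = g k \<or> g (Suc k) = g k + 1 \<or> g k = g (Suc k) + 1" if "k \<le> K" for k
    using g(3)[of k] g(4) that by (cases "k = K") (auto simp: curve_step_def)
  have out: "min (g (?L z)) (g (Suc (?L z))) < c z" if z: "z \<in> V" "z \<notin> S" for z
  proof (rule ccontr)
    let ?l = "?L z"
    assume "\<not> ?thesis"
    then have "c z \<le> min (g ?l) (g (Suc ?l))" "max (g ?l) (g (Suc ?l)) \<le> c z"
      using z by (auto simp: S_def)
    then have eq: "g ?l = c z" "g (Suc ?l) = c z" by auto
    have l: "?l \<le> K" "z \<in> layer a b ?l (c z)"
      using lev_le(1)[OF z(1), of a b K] lev_le(2)[OF z(1), of ?l K a b] by auto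
    show False
    proof (cases "?l = K")
      case True
      then show False using l eq g(1) empty by auto
    next
      case False
      then have "curve_step a b ?l (c z) (c z)" using g(3)[of ?l] eq l by simp
      then have "z \<in> layer a b (Suc ?l) (c z)" using l by (auto simp: curve_step_def)
      then show False using lev_le(2)[OF z(1), of "Suc ?l" K a b] l False by auto
    qed
  qed
  have sep: "h u < h v" if "m < K" "g (Suc m) = c u" "g m = c v" "c u \<noteq> c v"
    "u \<in> V" "v \<in> V" "?L u \<le> m" "m \<le> ?L v" for m u v
  proof -
    have "u \<notin> layer a b (Suc m) (c u)" using lev_le(2)[OF that(5), of "Suc m" K a b] that by auto
    moreover have "v \<in> layer a b m (c v)" using lev_le(2)[OF that(6), of m K a b] that by auto
    ultimately show ?thesis using g(3)[OF that(1)] that unfolding curve_step_def by auto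
  qed
  \<comment> \<open>Since \<open>v\<close> survives more than one round longer than
    \<open>u\<close>, some vertex below \<open>v\<close> in the column of \<open>u\<close> survives
    longer than \<open>u\<close>; by upward closure it lies above \<open>u\<close>.\<close>
  have far: "h u < h v" if uv: "?L u + 1 < ?L v" "c u \<in> {a..b}" "c u = c v + 1 \<or> c v = c u + 1" "u \<in> V" "v \<in> V" for u v
  proof -
    have "v \<in> layer a b (?L v) (c v)"
      using lev_le(1)[OF uv(5), of a b K] lev_le(2)[OF uv(5), of "?L v" K a b] by auto
    then obtain w where w: "w \<in> layer a b (?L u + 1) (c u)" "h w < h v"
      using layer_below[OF _ uv(1,2)] uv(3) by blast
    have "u \<notin> layer a b (?L u + 1) (c u)"
      using lev_le[OF uv(4), of a b K] lev_le[OF uv(5), of a b K] lev_le(2)[OF uv(4), of "?L u + 1" K a b] uv(1)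
      by auto
    then have "h u < h w" using layer_upward[OF w(1) uv(4)] by fastforce
    then show ?thesis using w by simp
  qed
  \<comment> \<open>Only cells whose levels differ by at most one can interleave, and for those the curve passes
    between them.\<close>
  have main: "\<not> (h x < h z \<and> h z < h y)"
    if x: "x \<in> S" and y: "y \<in> S" and z: "z \<in> V" "z \<notin> S" and xy: "c x = c y" "?L x = ?L y"
      and win: "c x \<in> {a..b}" "c z \<in> {a..b}" and nb: "c z = c x + 1 \<or> c x = c z + 1" for x y z
  proof
    assume lt: "h x < h z \<and> h z < h y"
    have V: "x \<in> V" "y \<in> V" using x y by (auto simp: S_def)
    define k where "k = ?L x"
    define l where "l = ?L z"
    have "\<not> l + 1 < k" "\<not> k + 1 < l"
      using far[of z x] far[of y z] lt V z win nb xy by (auto simp: k_def l_def)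
    then have kl: "k \<le> l + 1" "l \<le> k + 1" by auto
    have KK: "k \<le> K" "l \<le> K" using lev_le(1) V z by (auto simp: k_def l_def)
    have no1: "\<not> (g (Suc m) = c x \<and> g m = c z)" if "k \<le> m" "m \<le> l" for m
    proof
      assume a: "g (Suc m) = c x \<and> g m = c z"
      then have "m < K" using g(4) nb KK that by (cases "m = K") auto
      then show False using sep[of m y z] a lt V z xy nb that by (auto simp: k_def l_def)
    qed
    have no2: "\<not> (g (Suc m) = c z \<and> g m = c x)" if "l \<le> m" "m \<le> k" for m
    proof
      assume a: "g (Suc m) = c z \<and> g m = c x"
      then have "m < K" using g(4) nb KK that by (cases "m = K") auto
      then show False using sep[of m z x] a lt V z xy nb that by (auto simp: k_def l_def)
    qed
    have inx: "c x < max (g k) (g (Suc k))" using x by (auto simp: S_def k_def)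
    have outz: "min (g l) (g (Suc l)) < c z" using out[OF z] by (simp add: l_def)
    \<comment> \<open>Consecutive values of \<open>g\<close> differ by at most one, so the curve can
      separate these neighbouring cells only by moving directly between their two columns, which
      \<open>no1\<close> and \<open>no2\<close> forbid.\<close>
    consider "l = k" | "l = Suc k" | "k = Suc l" using kl by linarith
    then show False
    proof cases
      case 1
      then show False using no1[of k] no2[of k] step[OF KK(1)] inx outz nb by auto
    next
      case 2
      then show False using no1[of k] no1[of "Suc k"] step[OF KK(1)] step[OF KK(2)] inx outz nb
        by (auto simp: max_def min_def split: if_splits)
    next
      case 3
      then show False using no2[of l] no2[of "Suc l"] step[OF KK(1)] step[OF KK(2)] inx outz nb
        by (auto simp: max_def min_def split: if_splits)
    qed
  qed
  have low: "v \<in> S" if "v \<in> V" "c v \<le> a" for v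
  proof (rule ccontr)
    assume "v \<notin> S"
    then have "min (g (?L v)) (g (Suc (?L v))) < c v" by (rule out[OF that(1)])
    then show False using that(2) g(2)[of "?L v"] g(2)[of "Suc (?L v)"] by auto
  qed
  have high: "c v < b" if "v \<in> S" for v
    using that g(2)[of "?L v"] g(2)[of "Suc (?L v)"] by (auto simp: S_def)
  have same: "stair_adj c h x z \<longleftrightarrow> stair_adj c h y z"
    if x: "x \<in> S" and y: "y \<in> S" and z: "z \<in> V" "z \<notin> S" and cl: "cut_class a b K x = cut_class a b K y" for x y z
  proof -
    have cz: "a < c z" using low[OF z(1)] z(2) by force
    have V: "x \<in> V" "y \<in> V" using x y by (auto simp: S_def)
    show ?thesis
    proof (cases "c x < a")
      case True
      have "c x mod 2 < 2" by simp
      then have "c y < a" "c x mod 2 = c y mod 2" using cl True by (auto simp: cut_class_def split: if_splits)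
      moreover from this have "even (c x) \<longleftrightarrow> even (c y)" by presburger
      ultimately show ?thesis using True cz by (auto simp: stair_adj_def stair_less_def)
    next
      case False
      have "c y mod 2 < 2" by simp
      then have cy: "a \<le> c y" "c y = c x" "?L x = ?L y" using cl False by (auto simp: cut_class_def split: if_splits)
      show ?thesis
      proof (cases "c z = c x + 1 \<or> c x = c z + 1")
        case True
        have win: "c x \<in> {a..b}" "c z \<in> {a..b}" using True high[OF x] False cz by auto
        have "x \<noteq> z" using True by auto
        moreover have "y \<noteq> z" using True unfolding cy(2)[symmetric] by auto
        ultimately have ne: "h x \<noteq> h z" "h y \<noteq> h z"
          using inj_on_eq_iff[OF inj V(1) z(1)] inj_on_eq_iff[OF inj V(2) z(1)] by auto
        have "\<not> (h x < h z \<and> h z < h y)"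
          by (rule main[OF x y z]) (use cy win True in simp_all)
        moreover have "\<not> (h y < h z \<and> h z < h x)"
          by (rule main[OF y x z]) (use cy win True in simp_all)
        ultimately have e: "h x < h z \<longleftrightarrow> h y < h z" "h z < h x \<longleftrightarrow> h z < h y" using ne by linarith+
        show ?thesis unfolding stair_adj_def stair_less_def cy(2) e by (rule refl)
      next
        case False
        then show ?thesis unfolding stair_adj_def stair_less_def cy(2) by blast
      qed
    qed
  qed
  show ?thesis
  proof (intro exI[of _ S] conjI ballI impI)
    show "S \<subseteq> V" by (auto simp: S_def)
    show "v \<in> S" if "v \<in> V" "c v \<le> a" for v using low that .
    show "c v < b" if "v \<in> S" for v using high that .
    show "stair_adj c h x z \<longleftrightarrow> stair_adj c h y z"
      if "x \<in> S" "y \<in> S" "z \<in> V - S" "cut_class a b K x = cut_class a b K y" for x y z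
      by (rule same) (use that in auto)
  qed
qed

end

section \<open>Staircase representations of bichain graphs\<close>

lemma real_between:
  fixes A B F :: "real set"
  assumes "finite A" "finite B" "finite F" "\<And>x y. x \<in> A \<Longrightarrow> y \<in> B \<Longrightarrow> x < y"
  shows "\<exists>t. t \<notin> F \<and> (\<forall>x\<in>A. x < t) \<and> (\<forall>y\<in>B. t < y)"
proof -
  obtain a where a: "\<And>x. x \<in> A \<Longrightarrow> x \<le> a" "\<And>y. y \<in> B \<Longrightarrow> a < y"
  proof (cases "A = {}")
    case True
    show ?thesis
    proof (rule that[of "Min (insert 0 B) - 1"])
      fix y assume "y \<in> B"
      then have "Min (insert 0 B) \<le> y" using assms(2) by (intro Min_le) auto
      then show "Min (insert 0 B) - 1 < y" by simp
    qed (use True in simp)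
  next
    case False
    then show ?thesis using assms by (intro that[of "Max A"]) auto
  qed
  obtain b where b: "a < b" "\<And>y. y \<in> B \<Longrightarrow> b \<le> y"
  proof (cases "B = {}")
    case True
    then show ?thesis using that[of "a + 1"] by simp
  next
    case False
    then show ?thesis using assms(2) a(2) by (intro that[of "Min B"]) auto
  qed
  have "infinite ({a<..<b} - F)" using b(1) assms(3) by (intro Diff_infinite_finite) auto
  then obtain t where "t \<in> {a<..<b} - F" by (metis finite.emptyI ex_in_conv)
  then show ?thesis using a(1) b(2) by (intro exI[of _ t]) fastforce
qed

text \<open>Vertices are inserted by increasing \<open>c\<close>, so transitivity is used only
  through a middle vertex with the largest \<open>c\<close>. It puts all vertices that must be below
  the new one under all those that must be above, which leaves a gap for its height.\<close>

lemma locally_transitive_heights: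
  fixes c :: "'a \<Rightarrow> nat"
  assumes "finite V"
    and irr: "\<And>x. \<not> R x x"
    and trans: "\<And>u x w. u \<in> V \<Longrightarrow> x \<in> V \<Longrightarrow> w \<in> V \<Longrightarrow> c u \<le> c x \<Longrightarrow> c w \<le> c x \<Longrightarrow> R u x \<Longrightarrow> R x w \<Longrightarrow> R u w"
  shows "\<exists>h :: 'a \<Rightarrow> real. inj_on h V \<and> (\<forall>u\<in>V. \<forall>v\<in>V. R u v \<longrightarrow> h u < h v)"
proof -
  have "S \<subseteq> V \<Longrightarrow> \<exists>h :: 'a \<Rightarrow> real. inj_on h S \<and> (\<forall>u\<in>S. \<forall>v\<in>S. R u v \<longrightarrow> h u < h v)"
    if "finite S" for S
    using that
  proof (induction S rule: finite_ranking_induct[where f = c])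
    case empty
    then show ?case by simp
  next
    case (insert x S)
    then obtain h :: "'a \<Rightarrow> real" where h: "inj_on h S" "\<forall>u\<in>S. \<forall>v\<in>S. R u v \<longrightarrow> h u < h v" by auto
    show ?case
    proof (cases "x \<in> S")
      case True
      then show ?thesis using h by (auto simp: insert_absorb)
    next
      case False
      have "\<exists>t. t \<notin> h ` S \<and> (\<forall>s\<in>h ` {u \<in> S. R u x}. s < t) \<and> (\<forall>s\<in>h ` {u \<in> S. R x u}. t < s)"
      proof (rule real_between)
        fix s s' assume "s \<in> h ` {u \<in> S. R u x}" "s' \<in> h ` {u \<in> S. R x u}"
        then obtain u w where uw: "s = h u" "s' = h w" "u \<in> S" "w \<in> S" "R u x" "R x w" by auto
        then have "R u w" using trans[of u x w] insert.hyps insert.prems by blast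
        then show "s < s'" using h(2) uw by blast
      qed (use insert.hyps in auto)
      then obtain t where t: "t \<notin> h ` S" "\<And>u. u \<in> S \<Longrightarrow> R u x \<Longrightarrow> h u < t" "\<And>u. u \<in> S \<Longrightarrow> R x u \<Longrightarrow> t < h u"
        by auto
      have "inj_on (h(x := t)) (insert x S)"
        using h(1) t(1) False by (auto simp: inj_on_def)
      moreover have "\<forall>u\<in>insert x S. \<forall>v\<in>insert x S. R u v \<longrightarrow> (h(x := t)) u < (h(x := t)) v"
        using h(2) t(2,3) False irr by auto
      ultimately show ?thesis by blast
    qed
  qed
  then show ?thesis using assms(1) by blast
qed

text \<open>The four chains of a bichain graph in cyclic order, with \<open>L u v\<close> saying that \<open>u\<close> lies below
  \<open>v\<close> in the merged order of two cyclically consecutive chains. The last assumption forces the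
  order to wind around the cycle in one direction only.\<close>

locale spiral =
  fixes V :: "'a set" and r :: "'a \<Rightarrow> nat" and L :: "'a \<Rightarrow> 'a \<Rightarrow> bool"
  assumes fin: "finite V" and r4: "\<And>v. v \<in> V \<Longrightarrow> r v < 4"
    and tot: "\<And>u v. u \<in> V \<Longrightarrow> v \<in> V \<Longrightarrow> odd (r u + r v) \<Longrightarrow> L u v \<longleftrightarrow> \<not> L v u"
    and chain: "\<And>u w. u \<in> V \<Longrightarrow> w \<in> V \<Longrightarrow> r u = r w \<Longrightarrow>
      (\<forall>v\<in>V. odd (r v + r u) \<longrightarrow> L v u \<longrightarrow> L v w) \<or> (\<forall>v\<in>V. odd (r v + r u) \<longrightarrow> L v w \<longrightarrow> L v u)"
    and no_cycle: "\<And>a0 a1 a2 a3. a0 \<in> V \<Longrightarrow> a1 \<in> V \<Longrightarrow> a2 \<in> V \<Longrightarrow> a3 \<in> V \<Longrightarrow>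
      r a0 = 0 \<Longrightarrow> r a1 = 1 \<Longrightarrow> r a2 = 2 \<Longrightarrow> r a3 = 3 \<Longrightarrow>
      L a0 a1 \<Longrightarrow> L a1 a2 \<Longrightarrow> L a2 a3 \<Longrightarrow> L a3 a0 \<Longrightarrow> False"
begin

text \<open>Columns are filled by circling through the four chains: \<open>turn k\<close> consists
  of the vertices of chain \<open>k mod 4\<close> that are placed in column \<open>k\<close> or an
  earlier one.\<close>

primrec turn :: "nat \<Rightarrow> 'a set" where
  "turn 0 = {}"
| "turn (Suc k) = {u \<in> V. r u = Suc k mod 4 \<and> (\<forall>v\<in>V. r v = k mod 4 \<longrightarrow> v \<notin> turn k \<longrightarrow> L u v)}"

definition precedes :: "'a \<Rightarrow> 'a \<Rightarrow> bool" where
  "precedes u w \<longleftrightarrow> (\<forall>v\<in>V. odd (r v + r u) \<longrightarrow> L v u \<longrightarrow> L v w)"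

lemma precedes_cases: "u \<in> V \<Longrightarrow> w \<in> V \<Longrightarrow> r u = r w \<Longrightarrow> precedes u w \<or> precedes w u"
  using chain[of u w] by (auto simp: precedes_def)

lemma turnD: "u \<in> turn k \<Longrightarrow> u \<in> V \<and> r u = k mod 4"
  by (cases k) auto

lemma odd_mod4: "odd (Suc k mod 4 + k mod 4)" "odd (k mod 4 + Suc k mod 4)"
  by presburger+

lemma odd_mod4_cases:
  fixes i j :: nat
  assumes "odd (i mod 4 + j mod 4)"
  shows "j mod 4 = Suc i mod 4 \<or> j mod 4 = (i + 3) mod 4"
proof -
  have "n mod 4 = 0 \<or> n mod 4 = 1 \<or> n mod 4 = 2 \<or> n mod 4 = 3" for n :: nat by presburger
  from this[of i] this[of j] show ?thesis
    using assms mod_add_left_eq[of i 4 1, symmetric] mod_add_left_eq[of i 4 3, symmetric]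
    by (elim disjE) simp_all
qed

text \<open>The vertex that keeps \<open>w\<close> out of the turn is below \<open>w\<close> but not
  below \<open>u\<close>, so \<open>w\<close> cannot precede \<open>u\<close>.\<close>

lemma turn_downward:
  assumes "u \<in> turn k" "w \<in> V" "r w = k mod 4" "w \<notin> turn k"
  shows "precedes u w"
proof (cases k)
  case 0
  then show ?thesis using assms by simp
next
  case (Suc m)
  then obtain v where v: "v \<in> V" "r v = m mod 4" "v \<notin> turn m" "\<not> L w v" using assms by auto
  have u: "u \<in> V" "r u = Suc m mod 4" "L u v" using assms Suc v by auto
  have rw: "r w = Suc m mod 4" using assms(3) Suc by simp
  have od: "odd (r w + r v)" "odd (r u + r v)" "odd (r v + r w)"
    unfolding v(2) u(2) rw by (rule odd_mod4)+
  have "L v w" "\<not> L v u" using tot[OF assms(2) v(1) od(1)] tot[OF u(1) v(1) od(2)] v u by auto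
  then have "\<not> precedes w u" using v(1) od(3) unfolding precedes_def by blast
  then show ?thesis using precedes_cases[of u w] u assms Suc by auto
qed

text \<open>If \<open>v\<close> were below \<open>u\<close>, it would also be below all of the chain
  of \<open>u\<close> outside \<open>turn k\<close>, since \<open>u\<close> precedes these. That
  would put \<open>v\<close> into the next turn.\<close>

lemma turn_less_Suc:
  assumes "u \<in> turn k" "v \<in> V" "r v = Suc k mod 4" "v \<notin> turn (Suc k)"
  shows "L u v"
proof (rule ccontr)
  have u: "u \<in> V" "r u = k mod 4" using turnD[OF assms(1)] by simp_all
  assume "\<not> L u v"
  have od: "odd (r u + r v)" "odd (r v + r u)" unfolding u(2) assms(3) by (rule odd_mod4)+
  have "L v u" using tot[OF u(1) assms(2) od(1)] \<open>\<not> L u v\<close> by simp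
  then have "L v w" if "w \<in> V" "r w = k mod 4" "w \<notin> turn k" for w
    using turn_downward[OF assms(1) that] assms(2) od(2) unfolding precedes_def by blast
  then have "v \<in> turn (Suc k)" using assms(2,3) by simp
  then show False using assms(4) by blast
qed

lemma turn_mono4: "turn k \<subseteq> turn (k + 4)"
proof (induction k)
  case (Suc k)
  have m: "(k + 4) mod 4 = k mod 4" "Suc (k + 4) mod 4 = Suc k mod 4" by presburger+
  have "turn (Suc k) \<subseteq> turn (Suc (k + 4))" unfolding turn.simps m using Suc by blast
  then show ?case by simp
qed simp

text \<open>Climbing once around the four chains passes strictly beyond the minimal remaining vertex:
  otherwise the four witnesses would form a forbidden cycle.\<close>

lemma turn_progress:
  assumes "u \<in> V" "r u = 0" "\<And>a. a \<in> V \<Longrightarrow> r a = 0 \<Longrightarrow> a \<notin> turn (4 * m) \<Longrightarrow> precedes u a"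
  shows "u \<in> turn (4 * m + 4)"
proof (rule ccontr)
  have md: "4 * m mod 4 = 0" "Suc (4 * m) mod 4 = 1" "Suc (Suc (4 * m)) mod 4 = 2"
    "Suc (Suc (Suc (4 * m))) mod 4 = 3" "Suc (Suc (Suc (Suc (4 * m)))) mod 4 = 0" by presburger+
  have un: "\<exists>v\<in>V. r v = k mod 4 \<and> v \<notin> turn k \<and> L v x"
    if x: "x \<in> V" "r x = Suc k mod 4" "x \<notin> turn (Suc k)" for k x
  proof -
    obtain v where v: "v \<in> V" "r v = k mod 4" "v \<notin> turn k" "\<not> L x v" using x by auto
    have "odd (r v + r x)" unfolding v(2) x(2) by (rule odd_mod4)
    then have "L v x" using tot[OF v(1) x(1)] v(4) by blast
    then show ?thesis using v by blast
  qed
  assume "u \<notin> turn (4 * m + 4)"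
  moreover have "4 * m + 4 = Suc (Suc (Suc (Suc (4 * m))))" by simp
  ultimately have "u \<notin> turn (Suc (Suc (Suc (Suc (4 * m)))))" by metis
  then obtain a3 where a3: "a3 \<in> V" "r a3 = 3" "a3 \<notin> turn (Suc (Suc (Suc (4 * m))))" "L a3 u"
    using un[of u "Suc (Suc (Suc (4 * m)))"] assms(1,2) unfolding md by blast
  then obtain a2 where a2: "a2 \<in> V" "r a2 = 2" "a2 \<notin> turn (Suc (Suc (4 * m)))" "L a2 a3"
    using un[of a3 "Suc (Suc (4 * m))"] unfolding md by blast
  then obtain a1 where a1: "a1 \<in> V" "r a1 = 1" "a1 \<notin> turn (Suc (4 * m))" "L a1 a2"
    using un[of a2 "Suc (4 * m)"] unfolding md by blast
  then obtain a0 where a0: "a0 \<in> V" "r a0 = 0" "a0 \<notin> turn (4 * m)" "L a0 a1"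
    using un[of a1 "4 * m"] unfolding md by blast
  have "odd (r a3 + r u)" using a3(2) assms(2) by simp
  then have "L a3 a0" using assms(3)[OF a0(1-3)] a3(1,4) unfolding precedes_def by blast
  then show False by (rule no_cycle[OF a0(1) a1(1) a2(1) a3(1) a0(2) a1(2) a2(2) a3(2) a0(4) a1(4) a2(4)])
qed

lemma turn_exhausts_0: "\<exists>m. {u \<in> V. r u = 0} \<subseteq> turn (4 * m)"
proof -
  let ?A = "{u \<in> V. r u = 0}"
  have "\<exists>m. ?A \<subseteq> turn (4 * m)" if "card (?A - turn (4 * m)) = n" for n m
    using that
  proof (induction n arbitrary: m rule: less_induct)
    case (less n)
    let ?D = "?A - turn (4 * m)"
    show ?case
    proof (cases "?D = {}")
      case True
      then show ?thesis by blast
    next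
      case False
      have fD: "finite ?D" using fin by auto
      \<comment> \<open>Within a chain, \<open>precedes\<close> is inclusion of these sets, so a
        vertex with the smallest one is minimal among those remaining.\<close>
      define bel where "bel u = {v \<in> V. odd (r v + r u) \<and> L v u}" for u
      define u where "u = arg_min_on (card \<circ> bel) ?D"
      have u: "u \<in> ?D" unfolding u_def by (rule arg_min_if_finite(1)[OF fD False])
      have "precedes u a" if "a \<in> ?D" for a
      proof (rule ccontr)
        assume no: "\<not> precedes u a"
        then have "precedes a u" using precedes_cases[of u a] u that by auto
        then have "bel a \<subseteq> bel u" using u that by (auto simp: precedes_def bel_def)
        moreover have "bel a \<noteq> bel u" using no u that by (auto simp: precedes_def bel_def)
        ultimately have "card (bel a) < card (bel u)" using fin by (intro psubset_card_mono) (auto simp: bel_def)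
        moreover have "(card \<circ> bel) u \<le> (card \<circ> bel) a"
          unfolding u_def by (rule arg_min_least[OF fD False that])
        ultimately show False by simp
      qed
      then have u4: "u \<in> turn (4 * Suc m)" using turn_progress[of u m] u by (auto simp: add.commute)
      have "turn (4 * m) \<subseteq> turn (4 * Suc m)" using turn_mono4[of "4 * m"] by (simp add: add.commute)
      then have "?A - turn (4 * Suc m) \<subset> ?D" using u4 u by blast
      then have "card (?A - turn (4 * Suc m)) < card ?D" using fD by (rule psubset_card_mono[rotated])
      then show ?thesis using less.IH less.prems by blast
    qed
  qed
  then show ?thesis by blast
qed

text \<open>Once chain 0 is exhausted, the condition for entering the next turn is vacuous, so
  chains 1, 2 and 3 follow in the next three turns.\<close>

lemma turn_exhausts: "v \<in> V \<Longrightarrow> \<exists>k. v \<in> turn k"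
proof -
  assume v: "v \<in> V"
  obtain m where m: "{u \<in> V. r u = 0} \<subseteq> turn (4 * m)" using turn_exhausts_0 by auto
  have "i < 4 \<Longrightarrow> {u \<in> V. r u = i} \<subseteq> turn (4 * m + i)" for i
  proof (induction i)
    case (Suc i)
    have "(4 * m + i) mod 4 = i" "Suc (4 * m + i) mod 4 = Suc i" using Suc.prems by presburger+
    then show ?case using Suc by auto
  qed (use m in simp)
  from this[OF r4[OF v]] show ?thesis using v by blast
qed

definition col :: "'a \<Rightarrow> nat" where "col v = (LEAST k. v \<in> turn k)"

lemma col:
  assumes "v \<in> V"
  shows "v \<in> turn (col v)" and "k < col v \<Longrightarrow> v \<notin> turn k" and "col v mod 4 = r v"
proof -
  show 1: "v \<in> turn (col v)" unfolding col_def using turn_exhausts[OF assms] by (metis LeastI)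
  show "k < col v \<Longrightarrow> v \<notin> turn k" unfolding col_def by (rule not_less_Least)
  show "col v mod 4 = r v" using turnD[OF 1] by simp
qed

text \<open>The chain of \<open>v\<close> is cyclically the next or the previous one. In the first
  case \<open>v\<close> is outside the turn after that of \<open>u\<close>; in the second it is
  outside the turn before, and \<open>u\<close> was placed below all such vertices.\<close>

lemma col_far:
  assumes uv: "u \<in> V" "v \<in> V" and odd: "odd (r u + r v)" and lt: "col u + 1 < col v"
  shows "L u v"
proof -
  have p: "r u = col u mod 4" "r v = col v mod 4" using col(3) uv by auto
  consider "r v = Suc (col u) mod 4" | "r v = (col u + 3) mod 4"
    using odd odd_mod4_cases unfolding p by blast
  then show ?thesis
  proof cases
    case 1
    then show ?thesis using turn_less_Suc[OF col(1)[OF uv(1)] uv(2)] col(2)[OF uv(2), of "Suc (col u)"] lt by simp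
  next
    case 2
    have "col u \<noteq> 0" using col(1)[OF uv(1)] by (metis empty_iff turn.simps(1))
    then obtain k where k: "col u = Suc k" using not0_implies_Suc by blast
    have "r v = k mod 4" using 2 unfolding k by (simp add: mod_add_self2[of k 4, simplified])
    moreover have "v \<notin> turn k" using col(2)[OF uv(2), of k] lt k by simp
    ultimately show ?thesis using col(1)[OF uv(1)] uv(2) unfolding k by auto
  qed
qed

lemma stair_representation:
  "\<exists>c h. inj_on (h :: 'a \<Rightarrow> real) V \<and> (\<forall>v\<in>V. c v mod 4 = r v) \<and>
    (\<forall>u\<in>V. \<forall>v\<in>V. odd (r u + r v) \<longrightarrow> (L u v \<longleftrightarrow> stair_less c h u v))"
proof -
  \<comment> \<open>All constraints on heights: the strict chain order inside a column and
    \<open>L\<close> between neighbouring columns. With \<open>x\<close> in the rightmost column, a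
    path \<open>u\<close>, \<open>x\<close>, \<open>w\<close> uses at most two columns, hence the
    four cases below.\<close>
  define R where "R u v \<longleftrightarrow> col u = col v \<and> precedes u v \<and> \<not> precedes v u \<or>
    (col v = col u + 1 \<or> col u = col v + 1) \<and> L u v" for u v
  have par: "odd (r u + r v)" if "u \<in> V" "v \<in> V" "col v = col u + 1 \<or> col u = col v + 1" for u v
    using that(3) odd_mod4[of "col u"] odd_mod4[of "col v"]
    unfolding col(3)[OF that(1), symmetric] col(3)[OF that(2), symmetric] by auto
  have same: "r u = r v" if "u \<in> V" "v \<in> V" "col u = col v" for u v
    using that col(3) by metis
  have "\<exists>h :: 'a \<Rightarrow> real. inj_on h V \<and> (\<forall>u\<in>V. \<forall>v\<in>V. R u v \<longrightarrow> h u < h v)"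
  proof (rule locally_transitive_heights[OF fin])
    show "\<not> R x x" for x by (auto simp: R_def)
    fix u x w
    assume V: "u \<in> V" "x \<in> V" "w \<in> V" and le: "col u \<le> col x" "col w \<le> col x" and R: "R u x" "R x w"
    consider "col u = col x" "col w = col x" | "col u = col x" "col w + 1 = col x"
      | "col u + 1 = col x" "col w = col x" | "col u + 1 = col x" "col w + 1 = col x"
      using R le unfolding R_def by linarith
    then show "R u w"
    proof cases
      case 1
      then have "precedes u x" "\<not> precedes x u" "precedes x w" using R by (auto simp: R_def)
      moreover have "r u = r x" "r w = r x" by (rule same[OF V(1,2) 1(1)], rule same[OF V(3,2) 1(2)])
      ultimately have "precedes u w" "\<not> precedes w u" unfolding precedes_def by metis+
      then show ?thesis unfolding R_def using 1 by simp
    next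
      case 2
      then have d: "precedes u x" "L x w" using R by (auto simp: R_def)
      have o: "odd (r w + r u)" "odd (r u + r w)" "odd (r x + r w)" 
        by (rule par; use V 2 in simp)+
      have "\<not> L w x" using tot[OF V(2,3) o(3)] d by blast
      then have "\<not> L w u" using d o V unfolding precedes_def by blast
      then have "L u w" using tot[OF V(1,3) o(2)] by blast
      then show ?thesis unfolding R_def using 2 by simp
    next
      case 3
      then have d: "precedes x w" "L u x" using R by (auto simp: R_def)
      have "odd (r u + r x)" by (rule par) (use V 3 in simp_all)
      then have "L u w" using d V unfolding precedes_def by blast
      then show ?thesis unfolding R_def using 3 by simp
    next
      case 4
      then have d: "L u x" "L x w" using R by (auto simp: R_def)
      have o: "odd (r x + r w)" "odd (r x + r u)" "odd (r u + r x)"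
        by (rule par; use V 4 in simp)+
      then have "\<not> L x u" using tot[OF V(1,2) o(3)] d by blast
      then have "\<not> precedes w u" using d o V unfolding precedes_def by blast
      moreover have "col u = col w" using 4 by simp
      moreover from calculation have "precedes u w" using precedes_cases[OF V(1,3) same[OF V(1,3)]] by blast
      ultimately show ?thesis by (simp add: R_def)
    qed
  qed
  then obtain h :: "'a \<Rightarrow> real" where h: "inj_on h V" "\<And>u v. u \<in> V \<Longrightarrow> v \<in> V \<Longrightarrow> R u v \<Longrightarrow> h u < h v"
    by blast
  have "L u v \<longleftrightarrow> stair_less col h u v" if V: "u \<in> V" "v \<in> V" and od: "odd (r u + r v)" for u v
  proof -
    have t: "L u v \<longleftrightarrow> \<not> L v u" using tot[OF V od] .
    have ne: "col u \<noteq> col v" using same[OF V] od by auto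
    then consider "col v = col u + 1 \<or> col u = col v + 1" | "col u + 1 < col v" | "col v + 1 < col u"
      by linarith
    then show ?thesis
    proof cases
      case 1
      then have "L u v \<Longrightarrow> h u < h v" "L v u \<Longrightarrow> h v < h u"
        using h(2)[OF V] h(2)[OF V(2,1)] unfolding R_def by blast+
      then have e: "L u v \<longleftrightarrow> h u < h v" using t by fastforce
      have "\<not> col u + 1 < col v" using 1 by linarith
      then show ?thesis unfolding stair_less_def e using 1 by blast
    next
      case 2
      then show ?thesis using col_far[OF V od] unfolding stair_less_def by blast
    next
      case 3
      then have "L v u" using col_far[OF V(2,1)] od by (simp add: add.commute)
      moreover have "\<not> stair_less col h u v" using 3 by (simp add: stair_less_def)
      ultimately show ?thesis using t by blast
    qed
  qed
  then show ?thesis using h(1) col(3) by (intro exI[of _ col] exI[of _ h]) blast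
qed

end

text \<open>The four chains are numbered around a cycle, those of \<open>A\<close> by 0 and 2, those
  of \<open>B\<close> by 1 and 3. After complementing adjacency in one direction they satisfy the
  axioms of \<open>spiral\<close>, whose columns modulo 4 recover the chains.\<close>

lemma bichain_stair_representation:
  assumes wf: "wf_graph G" and bc: "bichain G"
  shows "\<exists>c h. inj_on (h :: 'a \<Rightarrow> real) (verts G) \<and> G = stair_graph (verts G) c h"
proof -
  obtain A B A1 A2 B1 B2 where AB: "A \<union> B = verts G" "A \<inter> B = {}"
    "\<And>x y. (x, y) \<in> edges G \<Longrightarrow> x \<in> A \<and> y \<in> B \<or> x \<in> B \<and> y \<in> A"
    "A = A1 \<union> A2" "is_chain G A1" "is_chain G A2" "B = B1 \<union> B2" "is_chain G B1" "is_chain G B2"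
    using bc unfolding bichain_def by blast
  define N where "N = nbhd G"
  have N: "y \<in> N x \<longleftrightarrow> (x, y) \<in> edges G" for x y by (simp add: N_def nbhd_def)
  have sym: "y \<in> N x \<longleftrightarrow> x \<in> N y" for x y using wf N by (auto simp: wf_graph_def)
  have NA: "N x \<subseteq> B" if "x \<in> A" for x using that AB(2,3) N by blast
  have ch: "N x \<subseteq> N y \<or> N y \<subseteq> N x"
    if "x \<in> A1 \<and> y \<in> A1 \<or> x \<in> A2 \<and> y \<in> A2 \<or> x \<in> B1 \<and> y \<in> B1 \<or> x \<in> B2 \<and> y \<in> B2" for x y
    using that AB(5,6,8,9) unfolding is_chain_def N_def by blast
  \<comment> \<open>Plot each vertex of \<open>A\<close> by its positions with respect to \<open>B1\<close> and \<open>B2\<close>; then \<open>ul x y\<close> says that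
    \<open>x\<close> is strictly to the upper left of \<open>y\<close>. Taking the vertices with nothing to their upper left
    as the new first chain of \<open>A\<close> fixes the winding direction.\<close>
  define ul where "ul x y \<longleftrightarrow> (\<exists>b\<in>B1. b \<in> N y \<and> b \<notin> N x) \<and> (\<exists>b\<in>B2 - B1. b \<in> N x \<and> b \<notin> N y)" for x y
  have ul_or: "ul x y \<or> ul y x" if xy: "x \<in> A" "y \<in> A" "\<not> N x \<subseteq> N y" "\<not> N y \<subseteq> N x" for x y
  proof -
    obtain p q where pq: "p \<in> N x" "p \<notin> N y" "q \<in> N y" "q \<notin> N x" using xy by blast
    then have "p \<in> B" "q \<in> B" using NA xy by auto
    moreover have "\<not> N p \<subseteq> N q" "\<not> N q \<subseteq> N p" using pq sym by blast+
    ultimately have "p \<in> B1 \<and> q \<in> B2 - B1 \<or> q \<in> B1 \<and> p \<in> B2 - B1"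
      using ch[of p q] AB(7) by blast
    then show ?thesis unfolding ul_def using pq by blast
  qed
  have ul_incomp: "\<not> N x \<subseteq> N y \<and> \<not> N y \<subseteq> N x" if "ul x y" for x y
    using that unfolding ul_def by blast
  have ul_trans: "ul x z" if xyz: "ul x y" "ul y z" for x y z
  proof -
    obtain b b' where b: "b \<in> B1" "b \<in> N y" "b \<notin> N x" "b' \<in> B2 - B1" "b' \<in> N x" "b' \<notin> N y"
      using xyz(1) unfolding ul_def by blast
    obtain d d' where d: "d \<in> B1" "d \<in> N z" "d \<notin> N y" "d' \<in> B2 - B1" "d' \<in> N y" "d' \<notin> N z"
      using xyz(2) unfolding ul_def by blast
    have "N d \<subseteq> N b" using ch[of b d] b d sym by blast
    then have "b \<in> N z" using d sym by blast
    moreover have "N b' \<subseteq> N d'" using ch[of b' d'] b d sym by blast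
    then have "b' \<notin> N z" using d sym by blast
    ultimately show ?thesis unfolding ul_def using b by blast
  qed
  define top where "top = {a \<in> A. \<not> (\<exists>x\<in>A. ul x a)}"
  have top: "N x \<subseteq> N y \<or> N y \<subseteq> N x" if "x \<in> top" "y \<in> top" for x y
    using ul_or[of x y] that unfolding top_def by blast
  \<comment> \<open>Such vertices would be pairwise incomparable, and three of these do not fit into
    the two chains of \<open>A\<close>. Hence the vertices outside \<open>top\<close> form a chain
    too.\<close>
  have no2: False if xyz: "x \<in> A" "y \<in> A" "z \<in> A" "ul z x" "ul x y" for x y z
  proof -
    note i = ul_incomp[OF xyz(4)] ul_incomp[OF xyz(5)] ul_incomp[OF ul_trans[OF xyz(4,5)]]
    have "x \<in> A1 \<or> x \<in> A2" "y \<in> A1 \<or> y \<in> A2" "z \<in> A1 \<or> z \<in> A2" using xyz AB(4) by auto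
    then show False using ch[of z x] ch[of x y] ch[of z y] i by blast
  qed
  have bot: "N x \<subseteq> N y \<or> N y \<subseteq> N x" if "x \<in> A - top" "y \<in> A - top" for x y
    using ul_or[of x y] that no2 unfolding top_def by blast
  define r :: "'a \<Rightarrow> nat" where
    "r v = (if v \<in> top then 0 else if v \<in> A then 2 else if v \<in> B1 then 3 else 1)" for v
  define L where "L u v \<longleftrightarrow> (if u \<in> A then v \<notin> N u else v \<in> N u)" for u v
  have topA: "top \<subseteq> A" by (auto simp: top_def)
  have ev: "even (r v) \<longleftrightarrow> v \<in> A" for v using topA by (auto simp: r_def)
  have chainB: "N x \<subseteq> N y \<or> N y \<subseteq> N x" if "x \<in> B" "y \<in> B" "r x = r y" for x y
    using ch[of x y] that AB(2,7) topA unfolding r_def by (auto split: if_splits)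
  have chainA: "N x \<subseteq> N y \<or> N y \<subseteq> N x" if "x \<in> A" "y \<in> A" "r x = r y" for x y
    using top[of x y] bot[of x y] that unfolding r_def by (auto split: if_splits)
  interpret spiral "verts G" r L
  proof
    show "finite (verts G)" using wf by (simp add: wf_graph_def)
    show "r v < 4" for v by (simp add: r_def)
    show "L u v \<longleftrightarrow> \<not> L v u" if "odd (r u + r v)" for u v
      using that ev[of u] ev[of v] sym[of u v] unfolding L_def by auto
    show "(\<forall>v\<in>verts G. odd (r v + r u) \<longrightarrow> L v u \<longrightarrow> L v w) \<or> (\<forall>v\<in>verts G. odd (r v + r u) \<longrightarrow> L v w \<longrightarrow> L v u)"
      if uw: "u \<in> verts G" "w \<in> verts G" "r u = r w" for u w
    proof (cases "u \<in> A")
      case True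
      then have "w \<in> A" using ev[of u] ev[of w] uw by simp
      then have "N u \<subseteq> N w \<or> N w \<subseteq> N u" using chainA True uw(3) by blast
      moreover have "L v x \<longleftrightarrow> v \<in> N x" if "odd (r v + r u)" for v x
        using that ev[of u] ev[of v] True sym[of v x] unfolding L_def by auto
      ultimately show ?thesis by blast
    next
      case False
      then have "w \<notin> A" using ev[of u] ev[of w] uw by simp
      then have "N u \<subseteq> N w \<or> N w \<subseteq> N u" using chainB False uw AB(1) by blast
      moreover have "L v x \<longleftrightarrow> v \<notin> N x" if "odd (r v + r u)" for v x
        using that ev[of u] ev[of v] False sym[of v x] unfolding L_def by auto
      ultimately show ?thesis by blast
    qed
    fix a0 a1 a2 a3
    assume V: "a0 \<in> verts G" "a1 \<in> verts G" "a2 \<in> verts G" "a3 \<in> verts G"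
      and r: "r a0 = 0" "r a1 = 1" "r a2 = 2" "r a3 = 3"
      and cyc: "L a0 a1" "L a1 a2" "L a2 a3" "L a3 a0"
    have m: "a0 \<in> top" "a1 \<notin> A" "a1 \<notin> B1" "a2 \<in> A" "a3 \<notin> A" "a3 \<in> B1"
      using r topA unfolding r_def by (auto split: if_splits)
    then have "a1 \<in> B2 - B1" using V(2) AB(1,7) by blast
    \<comment> \<open>The cycle makes \<open>a3\<close> in \<open>B1\<close> and \<open>a1\<close>
      in \<open>B2 - B1\<close> the witnesses that \<open>a2\<close> is to the upper left of
      \<open>a0\<close>, which contradicts the choice of \<open>top\<close>.\<close>
    then have "ul a2 a0" using m cyc topA sym unfolding L_def ul_def by (auto split: if_splits)
    then show False using m unfolding top_def by blast
  qed
  obtain c and h :: "'a \<Rightarrow> real" where ch: "inj_on h (verts G)" "\<And>v. v \<in> verts G \<Longrightarrow> c v mod 4 = r v"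
    "\<And>u v. u \<in> verts G \<Longrightarrow> v \<in> verts G \<Longrightarrow> odd (r u + r v) \<Longrightarrow> L u v \<longleftrightarrow> stair_less c h u v"
    using stair_representation by blast
  have cA: "even (c v) \<longleftrightarrow> v \<in> A" if "v \<in> verts G" for v
  proof -
    have "even (c v) \<longleftrightarrow> even (c v mod 4)" by presburger
    then show ?thesis using ev[of v] ch(2)[OF that] by simp
  qed
  have eq: "(x, y) \<in> edges G \<longleftrightarrow> stair_adj c h x y" if V: "x \<in> verts G" "y \<in> verts G" for x y
  proof (cases "x \<in> A \<longleftrightarrow> y \<in> A")
    case True
    then show ?thesis using cA[OF V(1)] cA[OF V(2)] AB(2,3) unfolding stair_adj_def by blast
  next
    case False
    have o: "odd (r x + r y)" "odd (r y + r x)" using False ev[of x] ev[of y] by auto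
    show ?thesis
      using False cA[OF V(1)] cA[OF V(2)] ch(3)[OF V o(1)] ch(3)[OF V(2,1) o(2)] N[of y x] N[of x y] sym[of x y]
      unfolding stair_adj_def L_def by auto
  qed
  have "edges G \<subseteq> verts G \<times> verts G" using wf by (simp add: wf_graph_def)
  then have "edges G = {(x, y). x \<in> verts G \<and> y \<in> verts G \<and> stair_adj c h x y}"
    using eq by blast
  then have "G = stair_graph (verts G) c h"
    unfolding stair_graph_def verts_def edges_def by (metis prod.collapse)
  then show ?thesis using ch(1) by blast
qed

section \<open>Graphs with a cut in every window\<close>

lemma exists_sorted_by_key:
  fixes key :: "'a \<Rightarrow> 'b::linorder"
  assumes "finite V" "inj_on key V"
  shows "\<exists>xs. distinct xs \<and> set xs = V \<and> sorted_wrt (\<lambda>x y. key x < key y) xs"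
proof -
  define ks where "ks = sorted_list_of_set (key ` V)"
  define g where "g = inv_into V key"
  have ks: "set ks = key ` V" "sorted_wrt (<) ks" "distinct ks" using assms(1) by (simp_all add: ks_def)
  have g: "key (g k) = k" if "k \<in> key ` V" for k using that by (simp add: g_def f_inv_into_f)
  have "set (map g ks) = V" using ks(1) assms(2) by (simp add: g_def image_image)
  moreover have "distinct (map g ks)"
    unfolding distinct_map using ks inj_on_inv_into[of "key ` V" key V] by (simp add: g_def)
  moreover have "sorted_wrt (\<lambda>x y. key x < key y) (map g ks)"
    unfolding sorted_wrt_map by (rule sorted_wrt_mono_rel[OF _ ks(2)]) (use g ks(1) in simp)
  ultimately show ?thesis by blast
qed

context staircase
begin

text \<open>The cuts of consecutive windows are nested and divide the vertices into blocks; the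
  layout lists block after block, each by increasing height. At any moment only one block is partly
  listed, so a listed vertex sees the rest through at most two cuts and the height order inside that
  block.\<close>

lemma cw_of_cuts:
  assumes L: "0 < w" and empty: "\<And>t. \<exists>j\<in>{t * w..t * w + w}. layer (t * w) (t * w + w) K j = {}"
  shows "cw_at_most (2 * (4 * (w + 2) * (K + 1) * w) + 1) (stair_graph V c h)"
proof -
  let ?cl = "\<lambda>t. cut_class (t * w) (t * w + w) K"
  define ok where "ok t T \<longleftrightarrow> T \<subseteq> V \<and> (\<forall>v\<in>V. c v \<le> t * w \<longrightarrow> v \<in> T) \<and> (\<forall>v\<in>T. c v < t * w + w) \<and>
    (\<forall>x\<in>T. \<forall>y\<in>T. \<forall>z\<in>V - T. ?cl t x = ?cl t y \<longrightarrow> (stair_adj c h x z \<longleftrightarrow> stair_adj c h y z))" for t T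
  have "\<exists>T. ok t T" for t
    using empty[of t] unfolding ok_def by (elim bexE) (rule cut_exists)
  then have "\<exists>S. \<forall>t. ok t (S t)" by (intro choice allI)
  then obtain S where "\<And>t. ok t (S t)" by blast
  note S' = this[unfolded ok_def]
  have S: "S t \<subseteq> V" "v \<in> V \<Longrightarrow> c v \<le> t * w \<Longrightarrow> v \<in> S t" "v \<in> S t \<Longrightarrow> c v < t * w + w" for t v
    using S'[of t] by blast+
  have S4: "stair_adj c h x z \<longleftrightarrow> stair_adj c h y z"
    if "x \<in> S t" "y \<in> S t" "z \<in> V" "z \<notin> S t" "?cl t x = ?cl t y" for t x y z
    using S'[of t] that by blast
  have "S t \<subseteq> S (Suc t)" for t 
  proof
    fix v assume v: "v \<in> S t"
    have "c v \<le> Suc t * w" using S(3)[OF v] by simp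
    then show "v \<in> S (Suc t)" using S(1,2) v by blast
  qed
  then have mono: "s \<le> t \<Longrightarrow> S s \<subseteq> S t" for s t by (rule lift_Suc_mono_le)
  define blk where "blk v = (LEAST t. v \<in> S t)" for v
  have blk: "v \<in> S t \<longleftrightarrow> blk v \<le> t" if "v \<in> V" for v t
  proof -
    have "c v \<le> c v * w" using L by simp
    then have "v \<in> S (c v)" using S(2) that by blast
    then have "v \<in> S (blk v)" unfolding blk_def by (rule LeastI)
    then show ?thesis using mono[of "blk v" t] unfolding blk_def by (auto intro: Least_le)
  qed
  define key where "key v = (blk v, h v)" for v
  have "inj_on key V" using inj by (auto simp: inj_on_def key_def)
  then obtain xs where xs: "distinct xs" "set xs = V" "sorted_wrt (\<lambda>x y. key x < key y) xs"
    using exists_sorted_by_key[OF fin] by blast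
  show ?thesis
  proof (rule cw_at_most_linear[OF wf_stair_graph[OF fin] xs(1)])
    show "set xs = verts (stair_graph V c h)" using xs by simp
    fix i assume "i \<le> length xs"
    define P where "P = set (take i xs)"
    define D where "D = set (drop i xs)"
    have PD: "P \<subseteq> V" "D \<subseteq> V" using xs(2) by (auto simp: P_def D_def dest: in_set_takeD in_set_dropD)
    have lt: "blk x < blk z \<or> blk x = blk z \<and> h x < h z" if "x \<in> P" "z \<in> D" for x z
    proof -
      have "sorted_wrt (\<lambda>x y. key x < key y) (take i xs @ drop i xs)" using xs(3) by simp
      then have "key x < key z" using that unfolding sorted_wrt_append P_def D_def by blast
      then show ?thesis by (auto simp: key_def)
    qed
    \<comment> \<open>The current block: listed vertices lie in blocks up to \<open>t\<close>, the
      remaining ones in blocks from \<open>t\<close> on. An empty \<open>D\<close> is treated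
      separately.\<close>
    define t where "t = Min (blk ` D)"
    have t: "blk x \<le> t" "t \<le> blk z" if "x \<in> P" "z \<in> D" for x z
    proof -
      have "t \<in> blk ` D" unfolding t_def by (rule Min_in) (use that in \<open>auto simp: D_def\<close>)
      then show "blk x \<le> t" using lt[OF that(1)] by fastforce
      show "t \<le> blk z" unfolding t_def by (rule Min_le) (use that in \<open>auto simp: D_def\<close>)
    qed
    \<comment> \<open>Earlier blocks are governed by the cut \<open>t - 1\<close>. In block
      \<open>t\<close>, later vertices of the same block are all higher, so only the column counts
      there, and the cut \<open>t\<close> handles later blocks.\<close>
    define f where "f x = (if blk x < t then (0 :: nat, ?cl (t - 1) x, 0) else (1, ?cl t x, c x + w - t * w))" for x
    let ?C = "{..<2::nat} \<times> ({..<w + 2} \<times> {..K}) \<times> {..<2 * w}"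
    let ?tr = "\<lambda>x. edges (stair_graph V c h) `` {x} \<inter> D"
    have same: "?tr x = ?tr y" if xy: "x \<in> P" "y \<in> P" "f x = f y" for x y
    proof -
      have "stair_adj c h x z \<longleftrightarrow> stair_adj c h y z" if z: "z \<in> D" for z
      proof (cases "blk x < t")
        case True
        then have b: "blk y < t" "?cl (t - 1) x = ?cl (t - 1) y"
          using xy(3) by (auto simp: f_def split: if_splits)
        then have "x \<in> S (t - 1)" "y \<in> S (t - 1)" "z \<notin> S (t - 1)"
          using blk True PD xy z t(2)[OF xy(1) z] by auto
        then show ?thesis by (intro S4[where t = "t - 1"]) (use b(2) z PD in auto)
      next
        case False
        then have b: "\<not> blk y < t" "?cl t x = ?cl t y" "c x + w - t * w = c y + w - t * w"
          using xy(3) by (auto simp: f_def split: if_splits)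
        have bt: "blk x = t" "blk y = t" using False b(1) t(1)[OF xy(1) z] t(1)[OF xy(2) z] by auto
        show ?thesis
        proof (cases "blk z = t")
          case True
          then have hz: "h x < h z" "h y < h z" using lt[OF xy(1) z] lt[OF xy(2) z] bt by auto
          \<comment> \<open>Vertices of block \<open>t\<close> lie beyond the previous cut, so the
            truncated subtraction in \<open>f\<close> loses nothing.\<close>
          have "t * w \<le> c v + w" if "v \<in> P" "blk v = t" for v
          proof (cases t)
            case (Suc s)
            then have "v \<notin> S s" using blk[of v s] that PD by auto
            then have "\<not> c v \<le> s * w" using S(2) that PD by blast
            then show ?thesis using Suc by simp
          qed simp
          then have "c x = c y" using b(3) xy bt by (metis add_right_cancel le_add_diff_inverse2)
          then show ?thesis using hz by (simp add: stair_adj_def stair_less_def)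
        next
          case False
          then have "z \<notin> S t" using blk[of z t] PD z t(2)[OF xy(1) z] by auto
          moreover have "x \<in> S t" "y \<in> S t" using blk bt PD xy by auto
          ultimately show ?thesis by (intro S4[where t = t]) (use b(2) z PD in auto)
        qed
      qed
      then show ?thesis using xy PD by auto
    qed
    show "card (?tr ` P) \<le> 4 * (w + 2) * (K + 1) * w"
    proof (cases "D = {}")
      case True
      then have "?tr ` P \<subseteq> {{}}" by auto
      then have "card (?tr ` P) \<le> card {{} :: 'a set}" by (rule card_mono[rotated]) simp
      also have "\<dots> \<le> 4 * (w + 2) * (K + 1) * w" using L by simp
      finally show ?thesis .
    next
      case False
      then obtain z where z: "z \<in> D" by blast
      have cl: "?cl s x \<in> {..<w + 2} \<times> {..K}" if "x \<in> S s" for x s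
        using S(3)[OF that] S(1)[of s] that lev_le(1)[of x _ _ K]
        by (auto simp: cut_class_def intro: less_trans[OF mod_less_divisor])
      have fC: "f x \<in> ?C" if x: "x \<in> P" for x
      proof (cases "blk x < t")
        case True
        then have "x \<in> S (t - 1)" using blk[of x "t - 1"] x PD by auto
        then show ?thesis using cl[of x "t - 1"] True L by (simp add: f_def)
      next
        case False
        then have "x \<in> S t" using blk[of x t] x PD t(1)[OF x z] by auto
        then show ?thesis using cl[of x t] False S(3)[of x t] L by (simp add: f_def)
      qed
      define g where "g k = ?tr (SOME x. x \<in> P \<and> f x = k)" for k
      have "?tr x = g (f x)" if x: "x \<in> P" for x
      proof -
        have "(SOME y. y \<in> P \<and> f y = f x) \<in> P \<and> f (SOME y. y \<in> P \<and> f y = f x) = f x"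
          by (rule someI[of _ x]) (use x in simp)
        then show ?thesis using same[of x "SOME y. y \<in> P \<and> f y = f x"] x unfolding g_def by metis
      qed
      then have "?tr ` P \<subseteq> g ` ?C" using fC by auto
      then have "card (?tr ` P) \<le> card (g ` ?C)" by (rule card_mono[rotated]) simp
      also have "\<dots> \<le> card ?C" by (rule card_image_le) simp
      also have "\<dots> = 4 * (w + 2) * (K + 1) * w" by (simp add: card_cartesian_product algebra_simps)
      finally show ?thesis .
    qed
  qed
qed

end

text \<open>If all columns of some window of \<open>G\<close> kept survivors for \<open>K\<close>
  rounds, then \<open>H\<close> would embed into \<open>G\<close> and belong to \<open>X\<close>. So
  every window has an empty layer, with \<open>w\<close> and \<open>K\<close> depending on
  \<open>H\<close> only.\<close>

lemma bounded_cw_of_forbidden: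
  assumes her: "hereditary X" and sub: "X \<subseteq> bichain_class"
    and H: "H \<in> bichain_class" "H \<notin> X"
  shows "bounded_cw X"
proof -
  have wfH: "wf_graph H" and bH: "bichain H" using H(1) by (auto simp: bichain_class_def)
  obtain c' and h' :: "nat \<Rightarrow> real" where rep: "inj_on h' (verts H)" "H = stair_graph (verts H) c' h'"
    using bichain_stair_representation[OF wfH bH] by blast
  have finH: "finite (verts H)" using wfH by (simp add: wf_graph_def)
  \<comment> \<open>Large enough for all columns of \<open>H\<close>; the factor 2 makes every
    window start \<open>t * w\<close> even, and the added 1 makes \<open>w\<close> positive.\<close>
  define w where "w = 2 * (Max (insert 0 (c' ` verts H)) + 1)"
  define K where "K = 2 * card (verts H)"
  have w: "0 < w" "even w" by (auto simp: w_def)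
  have cw: "c' x \<le> w" if "x \<in> verts H" for x
  proof -
    have "c' x \<le> Max (insert 0 (c' ` verts H))" using finH that by (intro Max_ge) auto
    then show ?thesis by (simp add: w_def)
  qed
  have "cw_at_most (2 * (4 * (w + 2) * (K + 1) * w) + 1) G" if G: "G \<in> X" for G
  proof -
    have wfG: "wf_graph G" and bG: "bichain G" using G sub by (auto simp: bichain_class_def)
    obtain c and h :: "nat \<Rightarrow> real" where G': "inj_on h (verts G)" "G = stair_graph (verts G) c h"
      using bichain_stair_representation[OF wfG bG] by blast
    interpret staircase "verts G" c h
      by unfold_locales (use wfG G'(1) in \<open>auto simp: wf_graph_def\<close>)
    have "\<exists>j\<in>{t * w..t * w + w}. layer (t * w) (t * w + w) K j = {}" for t
    proof (rule ccontr)
      assume "\<not> ?thesis"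
      then have ne: "layer (t * w) (t * w + w) K j \<noteq> {}" if "j \<in> {t * w..t * w + w}" for j
        using that by blast
      have "\<exists>f. inj_on f (verts H) \<and> f ` verts H \<subseteq> verts G \<and>
        (\<forall>x\<in>verts H. \<forall>y\<in>verts H. stair_adj c' h' x y \<longleftrightarrow> stair_adj c h (f x) (f y))"
        by (rule embed_of_layers[OF ne]) (use w finH rep(1) cw in \<open>auto simp: K_def\<close>)
      then obtain f where f: "inj_on f (verts H)" "f ` verts H \<subseteq> verts G"
        "\<forall>x\<in>verts H. \<forall>y\<in>verts H. stair_adj c' h' x y \<longleftrightarrow> stair_adj c h (f x) (f y)"
        by (elim exE conjE) (rule that)
      define U where "U = f ` verts H"
      have eH: "(x, y) \<in> edges H \<longleftrightarrow> x \<in> verts H \<and> y \<in> verts H \<and> stair_adj c' h' x y" for x y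
        by (subst rep(2)) simp
      have eG: "(x, y) \<in> edges G \<longleftrightarrow> x \<in> verts G \<and> y \<in> verts G \<and> stair_adj c h x y" for x y
        by (subst G'(2)) simp
      have "induced G U \<in> X" using her G f(2) unfolding hereditary_def U_def by blast
      moreover have "graph_iso H (induced G U)"
      proof -
        have "bij_betw f (verts H) (verts (induced G U))"
          using f(1) by (simp add: bij_betw_def induced_def verts_def U_def)
        moreover have "(x, y) \<in> edges H \<longleftrightarrow> (f x, f y) \<in> edges (induced G U)"
          if "x \<in> verts H" "y \<in> verts H" for x y
        proof -
          have "f x \<in> U" "f y \<in> U" "f x \<in> verts G" "f y \<in> verts G" using that f(2) by (auto simp: U_def)
          then have "(f x, f y) \<in> edges (induced G U) \<longleftrightarrow> stair_adj c h (f x) (f y)"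
            using eG[of "f x" "f y"] by (simp add: induced_def edges_def)
          then show ?thesis using eH f(3) that by simp
        qed
        ultimately show ?thesis unfolding graph_iso_def by blast
      qed
      ultimately have "H \<in> X" using her wfH unfolding hereditary_def by blast
      then show False using H(2) by simp
    qed
    then have "cw_at_most (2 * (4 * (w + 2) * (K + 1) * w) + 1) (stair_graph (verts G) c h)"
      by (rule cw_of_cuts[OF w(1)])
    then show ?thesis using G'(2) by simp
  qed
  then show ?thesis unfolding bounded_cw_def by blast
qed

theorem theorem13:
  shows "\<not> bounded_cw bichain_class \<and>
    (\<forall>X. hereditary X \<longrightarrow> X \<subset> bichain_class \<longrightarrow> bounded_cw X)"
  using bichain_class_unbounded bounded_cw_of_forbidden by blast

end
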